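(* Assume that there are constants $\beta_4\in(0,1]$, $c_d\ge1$ such that $$\operatorname*{ess\,sup}_{x\in B}\Phi(x,\beta_4t)\le c_d\operatorname*{ess\,inf}_{x\in B}\Phi(x,t)$$ whenever $1\le t\le1/r(B)$, for all balls $B\subset\Omega$ with $r(B)\le1$, and that there exist $1<p<q<\infty$ and $c_g\ge1$ such that, for $x\in\Omega$, $$\frac{\Phi(x,s)}{s^p}\le c_g\frac{\Phi(x,t)}{t^p}\quad\text{and}\quad\frac{\Phi(x,t)}{t^q}\le c_g\frac{\Phi(x,s)}{s^q}\qquad\text{whenever }0<s\le t.$$ Let $E\subset\Omega$ be such that $\mathcal H_\Phi(E)<\infty$. Then $Cap_\Phi(E)=0$.
   Context: $n\ge2$, $\Omega\subset\mathbb{R}^n$ is open, $r(B)$ denotes the radius of a ball $B$. $\Phi:\Omega\times[0,\infty)\to[0,\infty)$ is a Carathéodory function: $x\mapsto\Phi(x,t)$ is measurable for every $t\ge0$, and $t\mapsto\Phi(x,t)$ is continuous and non-decreasing for a.e. $x$; moreover $\Phi(x,0)=0$ and $\lim_{t\to\infty}\Phi(x,t)=\infty$ for every $x\in\Omega$. It is also assumed that ($\lesssim$ meaning inequality up to a constant independent of the variables): - $\Phi(x,t)\lesssim m(x)t^n$ for all $t\ge1$ and a.e. $x\in\Omega$, where $0\le m\in L^1_{\mathrm{loc}}(\Omega)$; - there is $\beta_3\in(0,1)$ with $\Phi(x,\beta_3)\le1$ and $\Phi(x,1/\beta_3)\ge1$ for every $x\in\Omega$; - $\Phi(x,s)/s\lesssim\Phi(x,t)/t$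 whenever $0<s\le t$ and $x\in\Omega$. Hausdorff type measure: for an open ball $B\subset\Omega$ set $h_\Phi(B)=\int_B\Phi(x,1/r(B))\,dx$. For $E\subset\Omega$ and $0<\kappa\le1$ let $\mathcal C^\kappa_E$ be the family of countable collections $\{B_j\}$ of balls $B_j\subset\Omega$ covering $E$ with $r(B_j)\le\kappa$; set $\mathcal H_{\Phi,\kappa}(E)=\inf_{\mathcal C^\kappa_E}\sum_jh_\Phi(B_j)$ and $\mathcal H_\Phi(E)=\lim_{\kappa\to0}\mathcal H_{\Phi,\kappa}(E)$. Capacity: $W^{1,\Phi}(\Omega)=\{f\in W^{1,1}(\Omega):\Phi(\cdot,|f|)+\Phi(\cdot,|Df|)\in L^1(\Omega)\}$ and $C_0(\Omega)$ is the space of continuous functions with compact support in $\Omega$. For compact $K\subset\Omega$, $$Cap^*_\Phi(K)=\inf_{f\in\mathcal R(K)}\int_\Omega\Phi(x,|Df|)\,dx,\qquad\mathcal R(K)=\{f\in W^{1,\Phi}(\Omega)\cap C_0(\Omega):f\ge1\text{ in }K,\ f\ge0\}.$$ For open $U\subset\Omega$, $Cap_\Phi(U)=\sup\{Cap^*_\Phi(K):K\subset U\text{ compact}\}$, and for general $E\subset\Omega$, $Cap_\Phi(E)=\inf\{Cap_\Phi(\tilde U):E\subset\tilde U\subset\Omega,\ \tilde U\text{ open}\}$. *)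

theory Defs
  imports "HOL-Analysis.Analysis" "HOL-Probability.Essential_Supremum"
begin

definition locally_integrable ::
    "'a::euclidean_space set \<Rightarrow> ('a \<Rightarrow> 'b::{banach, second_countable_topology}) \<Rightarrow> bool"
  where "locally_integrable \<Omega> f \<longleftrightarrow>
    (\<forall>K. compact K \<and> K \<subseteq> \<Omega> \<longrightarrow> integrable (lebesgue_on K) f)"

text \<open>The library's essential supremum is \<open>\<infinity>\<close> on non-measurable functions, so this essential
  infimum is \<open>-\<infinity>\<close> there.\<close>

definition essinf :: "'a measure \<Rightarrow> ('a \<Rightarrow> ereal) \<Rightarrow> ereal"
  where "essinf M f = - esssup M (\<lambda>x. - f x)"

subsection \<open>Weak gradients and Sobolev spaces\<close>

fun C_k :: "nat \<Rightarrow> ('a::euclidean_space \<Rightarrow> real) \<Rightarrow> bool"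
  where
    "C_k 0 \<phi> \<longleftrightarrow> continuous_on UNIV \<phi>"
  | "C_k (Suc k) \<phi> \<longleftrightarrow> (\<forall>x. \<phi> differentiable (at x)) \<and>
       (\<forall>i\<in>Basis. C_k k (\<lambda>x. frechet_derivative \<phi> (at x) i))"

definition test_function :: "'a::euclidean_space set \<Rightarrow> ('a \<Rightarrow> real) \<Rightarrow> bool"
  where "test_function \<Omega> \<phi> \<longleftrightarrow>
    (\<forall>k. C_k k \<phi>) \<and> compact (closure {x. \<phi> x \<noteq> 0}) \<and> closure {x. \<phi> x \<noteq> 0} \<subseteq> \<Omega>"

text \<open>The weak gradient is unique only up to null sets, so it is treated as a relation: \<open>g\<close> is
  one representative of \<open>Df\<close>.\<close>

definition weak_gradient ::
    "'a::euclidean_space set \<Rightarrow> ('a \<Rightarrow> real) \<Rightarrow> ('a \<Rightarrow> 'a) \<Rightarrow> bool"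
  where "weak_gradient \<Omega> f g \<longleftrightarrow>
    locally_integrable \<Omega> f \<and> locally_integrable \<Omega> g \<and>
    (\<forall>\<phi>. test_function \<Omega> \<phi> \<longrightarrow> (\<forall>i\<in>Basis.
      (LINT x|lebesgue_on \<Omega>. f x * frechet_derivative \<phi> (at x) i) =
      - (LINT x|lebesgue_on \<Omega>. (g x \<bullet> i) * \<phi> x)))"

definition W11 :: "'a::euclidean_space set \<Rightarrow> ('a \<Rightarrow> real) set"
  where "W11 \<Omega> = {f. integrable (lebesgue_on \<Omega>) f \<and>
    (\<exists>g. weak_gradient \<Omega> f g \<and> integrable (lebesgue_on \<Omega>) g)}"

definition W1Phi :: "('a::euclidean_space \<Rightarrow> real \<Rightarrow> real) \<Rightarrow> 'a set \<Rightarrow> ('a \<Rightarrow> real) set"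
  where "W1Phi \<Phi> \<Omega> = {f \<in> W11 \<Omega>. \<exists>g. weak_gradient \<Omega> f g \<and>
    integrable (lebesgue_on \<Omega>) (\<lambda>x. \<Phi> x \<bar>f x\<bar> + \<Phi> x (norm (g x)))}"

text \<open>Functions on \<open>\<Omega>\<close> are total functions whose values outside \<open>\<Omega>\<close> are irrelevant; hence the
  support is formed inside \<open>\<Omega>\<close>.\<close>

definition C0 :: "'a::euclidean_space set \<Rightarrow> ('a \<Rightarrow> real) set"
  where "C0 \<Omega> = {f. continuous_on \<Omega> f \<and>
    compact (closure {x\<in>\<Omega>. f x \<noteq> 0}) \<and> closure {x\<in>\<Omega>. f x \<noteq> 0} \<subseteq> \<Omega>}"

subsection \<open>The function \<open>\<Phi>\<close>\<close>

definition caratheodory :: "'a::euclidean_space set \<Rightarrow> ('a \<Rightarrow> real \<Rightarrow> real) \<Rightarrow> bool"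
  where "caratheodory \<Omega> \<Phi> \<longleftrightarrow>
    (\<forall>x\<in>\<Omega>. \<forall>t\<ge>0. \<Phi> x t \<ge> 0) \<and>
    (\<forall>t\<ge>0. (\<lambda>x. \<Phi> x t) \<in> borel_measurable (lebesgue_on \<Omega>)) \<and>
    (AE x in lebesgue_on \<Omega>. continuous_on {0..} (\<Phi> x) \<and> mono_on {0..} (\<Phi> x))"

subsection \<open>Hausdorff type measure\<close>

text \<open>A ball is encoded by its centre and radius. The value \<open>\<infinity>\<close> is possible, since \<open>\<Phi>\<close> is
  only controlled locally in \<open>\<Omega>\<close>.\<close>

definition h_Phi :: "('a::euclidean_space \<Rightarrow> real \<Rightarrow> real) \<Rightarrow> 'a \<times> real \<Rightarrow> ennreal"
  where "h_Phi \<Phi> = (\<lambda>(c, r). \<integral>\<^sup>+x. ennreal (\<Phi> x (1 / r)) \<partial>lebesgue_on (ball c r))"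

definition ball_covers ::
    "'a::euclidean_space set \<Rightarrow> real \<Rightarrow> 'a set \<Rightarrow> ('a \<times> real) set set"
  where "ball_covers \<Omega> \<kappa> E = {\<B>. countable \<B> \<and>
    (\<forall>(c, r)\<in>\<B>. 0 < r \<and> r \<le> \<kappa> \<and> ball c r \<subseteq> \<Omega>) \<and> E \<subseteq> (\<Union>(c, r)\<in>\<B>. ball c r)}"

definition H_Phi_kappa ::
    "('a::euclidean_space \<Rightarrow> real \<Rightarrow> real) \<Rightarrow> 'a set \<Rightarrow> real \<Rightarrow> 'a set \<Rightarrow> ennreal"
  where "H_Phi_kappa \<Phi> \<Omega> \<kappa> E =
    (INF \<B>\<in>ball_covers \<Omega> \<kappa> E. (\<Sum>\<^sub>\<infinity>B\<in>\<B>. h_Phi \<Phi> B))"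

definition H_Phi :: "('a::euclidean_space \<Rightarrow> real \<Rightarrow> real) \<Rightarrow> 'a set \<Rightarrow> 'a set \<Rightarrow> ennreal"
  where "H_Phi \<Phi> \<Omega> E = Lim (at_right 0) (\<lambda>\<kappa>. H_Phi_kappa \<Phi> \<Omega> \<kappa> E)"

text \<open>The limit exists, so that \<open>Lim\<close> is meaningful.\<close>

lemma H_Phi_kappa_antimono:
  assumes "\<kappa> \<le> \<kappa>'"
  shows "H_Phi_kappa \<Phi> \<Omega> \<kappa>' E \<le> H_Phi_kappa \<Phi> \<Omega> \<kappa> E"
proof -
  have "ball_covers \<Omega> \<kappa> E \<subseteq> ball_covers \<Omega> \<kappa>' E"
    using assms unfolding ball_covers_def by (blast intro: order_trans)
  then show ?thesis
    unfolding H_Phi_kappa_def by (rule INF_superset_mono) simp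
qed

lemma H_Phi_kappa_tendsto_SUP:
  "((\<lambda>\<kappa>. H_Phi_kappa \<Phi> \<Omega> \<kappa> E) \<longlongrightarrow> (SUP \<kappa>\<in>{0<..1}. H_Phi_kappa \<Phi> \<Omega> \<kappa> E)) (at_right 0)"
    (is "(?H \<longlongrightarrow> ?S) _")
proof (rule order_tendstoI)
  fix a assume "a < ?S"
  then obtain k where k: "0 < k" "k \<le> 1" "a < ?H k"
    by (auto simp: less_SUP_iff)
  have "eventually (\<lambda>\<kappa>. \<kappa> \<in> {0<..<k}) (at_right 0)"
    using k(1) by (rule eventually_at_right_real)
  then show "eventually (\<lambda>\<kappa>. a < ?H \<kappa>) (at_right 0)"
  proof eventually_elim
    case (elim \<kappa>)
    then have "?H k \<le> ?H \<kappa>" by (intro H_Phi_kappa_antimono) simp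
    with k(3) show ?case by (rule less_le_trans)
  qed
next
  fix a assume a: "?S < a"
  have "eventually (\<lambda>\<kappa>::real. \<kappa> \<in> {0<..<1}) (at_right 0)"
    by (rule eventually_at_right_real) simp
  then show "eventually (\<lambda>\<kappa>. ?H \<kappa> < a) (at_right 0)"
    by eventually_elim (auto intro!: le_less_trans[OF _ a] SUP_upper)
qed

lemma H_Phi_eq_SUP: "H_Phi \<Phi> \<Omega> E = (SUP \<kappa>\<in>{0<..1}. H_Phi_kappa \<Phi> \<Omega> \<kappa> E)"
  unfolding H_Phi_def by (rule tendsto_Lim) (simp_all add: H_Phi_kappa_tendsto_SUP)

subsection \<open>Capacity\<close>

definition cap_admissible ::
    "('a::euclidean_space \<Rightarrow> real \<Rightarrow> real) \<Rightarrow> 'a set \<Rightarrow> 'a set \<Rightarrow> ('a \<Rightarrow> real) set"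
  where "cap_admissible \<Phi> \<Omega> K =
    {f \<in> W1Phi \<Phi> \<Omega> \<inter> C0 \<Omega>. (\<forall>x\<in>K. f x \<ge> 1) \<and> (\<forall>x\<in>\<Omega>. f x \<ge> 0)}"

text \<open>All representatives \<open>g\<close> of \<open>Df\<close> give the same integral, so letting the infimum also range
  over them does not change its value.\<close>

definition Cap_star ::
    "('a::euclidean_space \<Rightarrow> real \<Rightarrow> real) \<Rightarrow> 'a set \<Rightarrow> 'a set \<Rightarrow> ennreal"
  where "Cap_star \<Phi> \<Omega> K =
    (INF (f, g)\<in>{(f, g). f \<in> cap_admissible \<Phi> \<Omega> K \<and> weak_gradient \<Omega> f g}.
      \<integral>\<^sup>+x. ennreal (\<Phi> x (norm (g x))) \<partial>lebesgue_on \<Omega>)"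

definition Cap_open ::
    "('a::euclidean_space \<Rightarrow> real \<Rightarrow> real) \<Rightarrow> 'a set \<Rightarrow> 'a set \<Rightarrow> ennreal"
  where "Cap_open \<Phi> \<Omega> U = (SUP K\<in>{K. compact K \<and> K \<subseteq> U}. Cap_star \<Phi> \<Omega> K)"

definition Cap ::
    "('a::euclidean_space \<Rightarrow> real \<Rightarrow> real) \<Rightarrow> 'a set \<Rightarrow> 'a set \<Rightarrow> ennreal"
  where "Cap \<Phi> \<Omega> E = (INF U\<in>{U. open U \<and> E \<subseteq> U \<and> U \<subseteq> \<Omega>}. Cap_open \<Phi> \<Omega> U)"

end

theory Submission
  imports Defs
begin

text \<open>The idea is that finite Hausdorff measure gives competitors of bounded energy living on sets of
  vanishing volume, and that averaging such competitors drives the energy to zero.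

  On a part of \<open>E\<close> inside a compact subset of \<open>\<Omega>\<close>, take a cover by balls of radius at most \<open>\<kappa>\<close> with sum
  of premeasures at most \<open>T > H_Phi \<Phi> \<Omega> E\<close>. The maximum of cutoffs of these balls, each supported in
  the doubled ball with gradient of order \<open>1 / r\<close>, is at least 1 on the cover. Its energy is at most
  a multiple of \<open>T\<close>, since the comparison of essential supremum and infimum makes the energy of one
  cutoff comparable with the premeasure of its ball (\<open>\<Phi>_double_ball_le_h_Phi\<close>). Moreover the
  gradients live on a set whose volume is at most a multiple of \<open>\<kappa> T\<close>
  (\<open>emeasure_double_ball_le_h_Phi\<close>).

  Now choose such functions \<open>f\<^sub>1, \<dots>, f\<^sub>N\<close> successively for rapidly decreasing \<open>\<kappa>\<close>. By absolute
  continuity of the integral, the energy densities of the earlier functions contribute almost nothing on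
  the support of the gradient of a later one; up to this error the gradients have disjoint supports. The
  lower growth exponent \<open>p\<close> then bounds the energy of the average by a constant times
  \<open>N (1 / N) powr p\<close>, which tends to 0 as \<open>p > 1\<close> (\<open>energy_small_of_barriers\<close>). This elementary
  argument takes the place of weak compactness, and it works for an arbitrary set \<open>E\<close> because only the
  covering balls, not the set, are involved. Countable subadditivity
  (\<open>energy_at_most_countable_union\<close>) passes from the parts of \<open>E\<close> to \<open>E\<close>.

  Two points need care. The competitors must have compact support, so a compact set inside the cover has
  to be given before finitely many balls are selected; the supports and energy densities are therefore
  controlled uniformly over all finite subfamilies by the notion \<open>barrier\<close>. And maxima are not
  differentiable; they are replaced by a logarithm of a sum of exponentials (\<open>cutoff_soft_max\<close>), whose
  gradient is still controlled by that of a single function at each point.\<close>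

section \<open>Integration of directional derivatives\<close>

lemma continuous_bounded_on_compact:
  fixes f :: "'a::topological_space \<Rightarrow> real"
  assumes "continuous_on UNIV f" "compact K"
  obtains M where "0 \<le> M" "\<And>x. x \<in> K \<Longrightarrow> \<bar>f x\<bar> \<le> M"
proof -
  have "bounded (f ` K)"
    using assms by (intro compact_imp_bounded compact_continuous_image) (auto intro: continuous_on_subset)
  then obtain M where M: "\<And>x. x \<in> K \<Longrightarrow> \<bar>f x\<bar> \<le> M" by (auto simp: bounded_iff)
  show ?thesis by (rule that[of "max M 0"]) (use M in fastforce)+
qed

lemma integrable_bounded_compact_support:
  fixes h :: "'a::euclidean_space \<Rightarrow> 'b::{banach, second_countable_topology}"
  assumes [measurable]: "h \<in> borel_measurable borel" and bd: "\<And>x. norm (h x) \<le> L"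
    and K: "compact K" "\<And>x. x \<notin> K \<Longrightarrow> h x = 0"
  shows "integrable lborel h"
proof (rule Bochner_Integration.integrable_bound)
  show "integrable lborel (\<lambda>x. L * indicator K x :: real)"
    using borel_compact[OF K(1)] emeasure_compact_finite[OF K(1)]
    by (intro integrable_mult_right integrable_real_indicator) auto
  have "L \<ge> 0" using bd[of undefined] norm_ge_zero order_trans by blast
  then show "AE x in lborel. norm (h x) \<le> norm (L * indicator K x :: real)"
    using bd K(2) by (intro AE_I2) (auto simp: indicator_def)
qed simp

lemma integrable_lborel_imp_lebesgue_on:
  fixes h :: "'a::euclidean_space \<Rightarrow> 'b::{banach, second_countable_topology}"
  assumes "integrable lborel h" "A \<in> sets lebesgue"
  shows "integrable (lebesgue_on A) h"
proof -
  have "integrable lebesgue h"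
    using assms(1) integrable_completion[of h lborel] by simp
  then have "integrable lebesgue (\<lambda>x. indicator A x *\<^sub>R h x)"
    using assms(2) by (intro integrable_mult_indicator) auto
  then show ?thesis using assms(2) by (simp add: integrable_restrict_space)
qed

lemma integral_lebesgue_on_eq_lborel:
  fixes h :: "'a::euclidean_space \<Rightarrow> real"
  assumes "h \<in> borel_measurable borel" "A \<in> sets lebesgue" "\<And>x. x \<notin> A \<Longrightarrow> h x = 0"
  shows "(LINT x|lebesgue_on A. h x) = (LINT x|lborel. h x)"
proof -
  have "(LINT x|lebesgue_on A. h x) = (LINT x|lebesgue. indicator A x *\<^sub>R h x)"
    using assms(2) by (subst integral_restrict_space) auto
  also have "\<dots> = (LINT x|lebesgue. h x)"
    using assms(3) by (intro Bochner_Integration.integral_cong) (auto simp: indicator_def)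
  also have "\<dots> = (LINT x|lborel. h x)"
    using assms(1) by (intro integral_completion) auto
  finally show ?thesis .
qed

lemma difference_quotient_tendsto:
  fixes u :: "'a::real_vector \<Rightarrow> real"
  assumes "((\<lambda>t. u (x + t *\<^sub>R e)) has_real_derivative d) (at 0)"
  shows "(\<lambda>n. real (Suc n) * (u (x + (1 / real (Suc n)) *\<^sub>R e) - u x)) \<longlonglongrightarrow> d"
proof -
  have l: "(\<lambda>h. (u (x + h *\<^sub>R e) - u x) / h) \<midarrow>0\<rightarrow> d"
    using assms by (simp add: DERIV_def)
  have s: "filterlim (\<lambda>n. 1 / real (Suc n)) (at 0) sequentially"
    using lim_inverse_n' LIMSEQ_Suc[OF lim_inverse_n'] by (auto simp: filterlim_at)
  show ?thesis using filterlim_compose[OF l s] by (simp add: field_simps)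
qed

lemma directional_derivative_measurable:
  fixes u d :: "'a::euclidean_space \<Rightarrow> real"
  assumes cont: "continuous_on UNIV u"
    and der: "\<And>x. ((\<lambda>t. u (x + t *\<^sub>R e)) has_real_derivative d x) (at 0)"
  shows "d \<in> borel_measurable borel"
proof -
  have [measurable]: "u \<in> borel_measurable borel"
    using cont by (rule borel_measurable_continuous_onI)
  show ?thesis
    by (rule borel_measurable_LIMSEQ_real[where u="\<lambda>n x. real (Suc n) * (u (x + (1 / real (Suc n)) *\<^sub>R e) - u x)"])
      (use difference_quotient_tendsto[OF der] in auto)
qed

text \<open>The integral of a difference quotient vanishes because Lebesgue measure is translation
  invariant; the bound on the derivative lets the limit pass under the integral. Applied to a product
  \<open>f \<phi>\<close>, this is integration by parts in the generality needed for weak gradients: the derivative has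
  to exist everywhere and be bounded, but not to be continuous.\<close>

lemma integral_directional_derivative_eq_0:
  fixes u d :: "'a::euclidean_space \<Rightarrow> real"
  assumes cont: "continuous_on UNIV u"
    and der: "\<And>x. ((\<lambda>t. u (x + t *\<^sub>R e)) has_real_derivative d x) (at 0)"
    and bd: "\<And>x. \<bar>d x\<bar> \<le> L"
    and K: "compact K" "\<And>x. x \<notin> K \<Longrightarrow> u x = 0"
  shows "integrable lborel d" "(LINT x|lborel. d x) = 0"
proof -
  define D where "D n x = real (Suc n) * (u (x + (1 / real (Suc n)) *\<^sub>R e) - u x)" for n x
  note lim = difference_quotient_tendsto[OF der, folded D_def]
  have [measurable]: "u \<in> borel_measurable borel" "d \<in> borel_measurable borel"
    using cont directional_derivative_measurable[OF cont der]
    by (auto intro: borel_measurable_continuous_onI)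
  obtain R where R: "K \<subseteq> ball 0 R"
    using compact_imp_bounded[OF K(1)] bounded_subset_ballD by blast
  have L0: "L \<ge> 0" using bd[of undefined] by linarith
  have D_le: "\<bar>D n x\<bar> \<le> L * indicator (cball 0 (R + norm e)) x" for n x
  proof (cases "x \<in> cball 0 (R + norm e)")
    case True
    define h where "h = 1 / real (Suc n)"
    have dt: "((\<lambda>s. u (x + s *\<^sub>R e)) has_real_derivative d (x + t *\<^sub>R e)) (at t)" for t
    proof -
      have "((\<lambda>s. u ((x + t *\<^sub>R e) + (s + - t) *\<^sub>R e)) has_real_derivative d (x + t *\<^sub>R e)) (at t)"
        using der[of "x + t *\<^sub>R e"] DERIV_shift[of "\<lambda>s. u ((x + t *\<^sub>R e) + s *\<^sub>R e)" _ t "- t"]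
        by simp
      then show ?thesis by (simp add: algebra_simps)
    qed
    have "h > 0" by (simp add: h_def)
    then obtain z where z: "u (x + h *\<^sub>R e) - u (x + 0 *\<^sub>R e) = (h - 0) * d (x + z *\<^sub>R e)"
      using MVT2[of 0 h "\<lambda>s. u (x + s *\<^sub>R e)" "\<lambda>t. d (x + t *\<^sub>R e)"] dt by blast
    have "D n x = d (x + z *\<^sub>R e)" using z by (simp add: D_def h_def field_simps)
    then show ?thesis using bd True by simp
  next
    case False
    have hle: "norm ((1 / real (Suc n)) *\<^sub>R e) \<le> norm e"
      using mult_right_mono[of "1 / real (Suc n)" 1 "norm e"] by simp
    have "norm x > R + norm e" using False by simp
    then have "norm (x + (1 / real (Suc n)) *\<^sub>R e) > R" "norm x > R"
      using norm_diff_ineq[of x "(1 / real (Suc n)) *\<^sub>R e"] hle norm_ge_zero[of e] by linarith+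
    then have "x \<notin> K" "x + (1 / real (Suc n)) *\<^sub>R e \<notin> K" using R by auto
    then show ?thesis using K(2) False by (simp add: D_def)
  qed
  have int_dom: "integrable lborel (\<lambda>x::'a. L * indicator (cball 0 (R + norm e)) x)"
    using emeasure_lborel_cball_finite[of "0::'a" "R + norm e"]
    by (intro integrable_mult_right integrable_real_indicator) auto
  have meas: "D n \<in> borel_measurable lborel" for n unfolding D_def by measurable
  have ae: "AE x in lborel. (\<lambda>n. D n x) \<longlonglongrightarrow> d x"
     "AE x in lborel. norm (D n x) \<le> L * indicator (cball 0 (R + norm e)) x" for n
    using lim D_le by auto
  show "integrable lborel d"
    by (rule integrable_dominated_convergence[OF _ meas int_dom]) (use ae in auto)
  obtain M where M: "0 \<le> M" "\<And>x. x \<in> K \<Longrightarrow> \<bar>u x\<bar> \<le> M"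
    using continuous_bounded_on_compact[OF cont K(1)] by blast
  have "norm (u x) \<le> M" for x
    using M(1) M(2)[of x] K(2)[of x] by (cases "x \<in> K") auto
  then have iu: "integrable lborel u"
    using K by (intro integrable_bounded_compact_support[where K=K]) auto
  have tr: "integrable lborel (\<lambda>x. u (x + c))" "(LINT x|lborel. u (x + c)) = (LINT x|lborel. u x)" for c
  proof -
    have "lborel = distr lborel borel ((+) c)" by (simp add: lborel_distr_plus)
    then show "integrable lborel (\<lambda>x. u (x + c))"
      using iu integrable_distr[of "(+) c" lborel borel u] by (simp add: add.commute)
    have "(LINT x|lborel. u x) = (LINT x|distr lborel borel ((+) c). u x)"
      by (simp add: lborel_distr_plus)
    also have "\<dots> = (LINT x|lborel. u (c + x))" by (subst integral_distr) auto
    finally show "(LINT x|lborel. u (x + c)) = (LINT x|lborel. u x)" by (simp add: add.commute)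
  qed
  have "(LINT x|lborel. D n x) = 0" for n
    unfolding D_def using iu tr by (simp add: Bochner_Integration.integral_diff)
  moreover have "(\<lambda>n. LINT x|lborel. D n x) \<longlonglongrightarrow> (LINT x|lborel. d x)"
    by (rule integral_dominated_convergence[OF _ meas int_dom]) (use ae in auto)
  ultimately show "(LINT x|lborel. d x) = 0" using LIMSEQ_unique[of "\<lambda>n. 0::real"] by auto
qed

section \<open>Differentiable cutoffs and their weak gradients\<close>

text \<open>Competitors for the capacity. They are differentiable at every point, so that the pointwise
  gradient is a weak gradient by an elementary argument and no theorem on almost everywhere
  differentiability of Lipschitz functions (such as maxima of cutoffs) enters.\<close>

definition cutoff_with_gradient ::
    "'a::euclidean_space set \<Rightarrow> ('a \<Rightarrow> real) \<Rightarrow> ('a \<Rightarrow> 'a) \<Rightarrow> bool"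
  where "cutoff_with_gradient \<Omega> f g \<longleftrightarrow>
    (\<forall>x. (f has_derivative (\<lambda>h. g x \<bullet> h)) (at x)) \<and> (\<forall>x. 0 \<le> f x) \<and> bounded (range g) \<and>
    (\<exists>K. compact K \<and> K \<subseteq> \<Omega> \<and> (\<forall>x. x \<notin> K \<longrightarrow> f x = 0))"

lemma cutoff_gradient_eq_0:
  assumes der: "(f has_derivative (\<lambda>h. g \<bullet> h)) (at x)"
    and z: "closed K" "\<And>y. y \<notin> K \<Longrightarrow> f y = 0" "x \<notin> K"
  shows "(g::'a::euclidean_space) = 0"
proof -
  have "(f has_derivative (\<lambda>h. 0)) (at x)"
    by (rule has_derivative_transform_within_open[of "\<lambda>_. 0" _ _ _ "- K"])
      (use z in \<open>auto simp: open_Compl\<close>)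
  then have "(\<lambda>h. g \<bullet> h) = (\<lambda>h. 0)" using der has_derivative_unique by blast
  then show ?thesis by (metis inner_eq_zero_iff)
qed

lemma cutoff_continuous:
  assumes "cutoff_with_gradient \<Omega> f g"
  shows "continuous_on UNIV f"
  using assms has_derivative_continuous
  unfolding cutoff_with_gradient_def continuous_on_eq_continuous_within by blast

lemma directional_derivative_of_gradient:
  assumes "(f has_derivative (\<lambda>h. D h)) (at x)"
  shows "((\<lambda>t. f (x + t *\<^sub>R e)) has_real_derivative D e) (at 0)"
proof -
  have l: "((\<lambda>t::real. x + t *\<^sub>R e) has_derivative (\<lambda>t. t *\<^sub>R e)) (at 0)"
    by (auto intro!: derivative_eq_intros)
  have "((\<lambda>t. f (x + t *\<^sub>R e)) has_derivative (\<lambda>t. D (t *\<^sub>R e))) (at 0)"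
    using has_derivative_compose[OF l, of f D] assms by simp
  moreover have "(\<lambda>t. D (t *\<^sub>R e)) = (\<lambda>t. D e * t)"
    using has_derivative_linear[OF assms] by (auto simp: linear_cmul)
  ultimately show ?thesis by (simp add: has_field_derivative_def)
qed

lemma cutoff_gradient_measurable:
  fixes g :: "'a::euclidean_space \<Rightarrow> 'a"
  assumes c: "cutoff_with_gradient \<Omega> f g"
  shows "g \<in> borel_measurable borel"
proof (subst borel_measurable_euclidean_space, rule ballI)
  fix i :: 'a assume "i \<in> Basis"
  show "(\<lambda>x. g x \<bullet> i) \<in> borel_measurable borel"
    by (rule directional_derivative_measurable[OF cutoff_continuous[OF c], of i])
      (use c in \<open>auto simp: cutoff_with_gradient_def intro!: directional_derivative_of_gradient\<close>)
qed

lemma cutoff_bounds: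
  fixes g :: "'a::euclidean_space \<Rightarrow> 'a"
  assumes c: "cutoff_with_gradient \<Omega> f g"
  obtains K M L where "compact K" "K \<subseteq> \<Omega>" "\<And>x. x \<notin> K \<Longrightarrow> f x = 0" "\<And>x. x \<notin> K \<Longrightarrow> g x = 0"
    "\<And>x. \<bar>f x\<bar> \<le> M" "\<And>x. norm (g x) \<le> L" "0 \<le> M" "0 \<le> L"
proof -
  obtain K where K: "compact K" "K \<subseteq> \<Omega>" "\<And>x. x \<notin> K \<Longrightarrow> f x = 0"
    using c by (auto simp: cutoff_with_gradient_def)
  have g0: "g x = 0" if "x \<notin> K" for x
    using c cutoff_gradient_eq_0[of f "g x" x K] K that
    by (auto simp: cutoff_with_gradient_def compact_imp_closed)
  obtain M where M: "0 \<le> M" "\<And>x. x \<in> K \<Longrightarrow> \<bar>f x\<bar> \<le> M"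
    using continuous_bounded_on_compact[OF cutoff_continuous[OF c] K(1)] by blast
  have M': "\<bar>f x\<bar> \<le> M" for x using M(1) M(2)[of x] K(3)[of x] by (cases "x \<in> K") auto
  obtain L where L: "\<And>x. norm (g x) \<le> L"
    using c by (auto simp: cutoff_with_gradient_def bounded_iff)
  have "0 \<le> L" using L[of undefined] norm_ge_zero order_trans by blast
  show ?thesis
    by (rule that[of K M L]) (use K M M' L g0 \<open>0 \<le> L\<close> in auto)
qed

text \<open>For a test function \<open>\<phi>\<close>, the product \<open>f \<phi>\<close> has a bounded derivative and compact support, so the
  integral of its partial derivatives vanishes; the product rule splits this integral.\<close>

lemma cutoff_weak_gradient:
  fixes g :: "'a::euclidean_space \<Rightarrow> 'a"
  assumes c: "cutoff_with_gradient \<Omega> f g" and \<Omega>: "open \<Omega>"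
  shows "integrable lborel f" "integrable lborel g" "weak_gradient \<Omega> f g"
proof -
  obtain K M L where K: "compact K" "K \<subseteq> \<Omega>" "\<And>x. x \<notin> K \<Longrightarrow> f x = 0" "\<And>x. x \<notin> K \<Longrightarrow> g x = 0"
    and M: "\<And>x. \<bar>f x\<bar> \<le> M" and L: "\<And>x. norm (g x) \<le> L" "0 \<le> M" "0 \<le> L"
    using cutoff_bounds[OF c] by metis
  have out: "f x = 0" "g x = 0" if "x \<notin> \<Omega>" for x using K that by blast+
  note fcont = cutoff_continuous[OF c]
  have [measurable]: "f \<in> borel_measurable borel" "g \<in> borel_measurable borel"
    using fcont cutoff_gradient_measurable[OF c] by (auto intro: borel_measurable_continuous_onI)
  show fi: "integrable lborel f"
    using K M by (intro integrable_bounded_compact_support[of f M K]) auto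
  show gi: "integrable lborel g"
    using K L by (intro integrable_bounded_compact_support[of g L K]) auto
  have "(LINT x|lebesgue_on \<Omega>. f x * frechet_derivative \<phi> (at x) i) =
      - (LINT x|lebesgue_on \<Omega>. (g x \<bullet> i) * \<phi> x)" if t: "test_function \<Omega> \<phi>" and i: "i \<in> Basis" for \<phi> i
  proof -
    define d where "d x = frechet_derivative \<phi> (at x) i" for x
    have "C_k (Suc 0) \<phi>" using t unfolding test_function_def by blast
    then have dif: "\<And>x. \<phi> differentiable (at x)" and dc: "continuous_on UNIV d"
      using i unfolding d_def by auto
    have \<phi>c: "continuous_on UNIV \<phi>"
      using dif differentiable_imp_continuous_within continuous_on_eq_continuous_within by blast
    obtain A B where A: "\<And>x. x \<in> K \<Longrightarrow> \<bar>d x\<bar> \<le> A" and B: "\<And>x. x \<in> K \<Longrightarrow> \<bar>\<phi> x\<bar> \<le> B"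
      using continuous_bounded_on_compact[OF dc K(1)] continuous_bounded_on_compact[OF \<phi>c K(1)] by metis
    have [measurable]: "d \<in> borel_measurable borel" "\<phi> \<in> borel_measurable borel"
      using dc \<phi>c by (auto intro: borel_measurable_continuous_onI)
    have b1: "\<bar>f x * d x\<bar> \<le> max 0 (M * A)" for x
    proof (cases "x \<in> K")
      case True then show ?thesis
        using mult_mono[OF M[of x] A[of x]] L by (auto simp: abs_mult)
    qed (use K in auto)
    have b2: "\<bar>(g x \<bullet> i) * \<phi> x\<bar> \<le> max 0 (L * B)" for x
    proof (cases "x \<in> K")
      case True
      have "\<bar>g x \<bullet> i\<bar> \<le> L" using Basis_le_norm[OF i, of "g x"] L(1)[of x] by linarith
      then show ?thesis
        using True mult_mono[OF _ B[of x], of "\<bar>g x \<bullet> i\<bar>" L] L by (auto simp: abs_mult)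
    qed (use K in auto)
    have i1: "integrable lborel (\<lambda>x. f x * d x)"
      using K b1 by (intro integrable_bounded_compact_support[of _ "max 0 (M * A)" K]) auto
    have i2: "integrable lborel (\<lambda>x. (g x \<bullet> i) * \<phi> x)"
      using K b2 by (intro integrable_bounded_compact_support[of _ "max 0 (L * B)" K]) auto
    have "(LINT x|lborel. f x * d x + (g x \<bullet> i) * \<phi> x) = 0"
    proof (rule integral_directional_derivative_eq_0(2)[where u="\<lambda>x. f x * \<phi> x" and K=K and e=i
          and L="max 0 (M * A) + max 0 (L * B)"])
      show "continuous_on UNIV (\<lambda>x. f x * \<phi> x)" using fcont \<phi>c by (intro continuous_intros)
      show "((\<lambda>t. f (x + t *\<^sub>R i) * \<phi> (x + t *\<^sub>R i)) has_real_derivative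
            f x * d x + g x \<bullet> i * \<phi> x) (at 0)" for x
      proof -
        have "(f has_derivative (\<lambda>h. g x \<bullet> h)) (at x)"
          using c by (auto simp: cutoff_with_gradient_def)
        moreover have "(\<phi> has_derivative (frechet_derivative \<phi> (at x))) (at x)"
          using dif frechet_derivative_works by blast
        ultimately have "((\<lambda>x. f x * \<phi> x) has_derivative
            (\<lambda>h. f x * frechet_derivative \<phi> (at x) h + (g x \<bullet> h) * \<phi> x)) (at x)"
          by (rule has_derivative_mult)
        from directional_derivative_of_gradient[OF this, of i] show ?thesis
          by (simp add: d_def)
      qed
      show "\<bar>f x * d x + g x \<bullet> i * \<phi> x\<bar> \<le> max 0 (M * A) + max 0 (L * B)" for x
        using b1[of x] b2[of x] by linarith
    qed (use K in auto)
    then have "(LINT x|lborel. f x * d x) = - (LINT x|lborel. (g x \<bullet> i) * \<phi> x)"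
      using i1 i2 by simp
    moreover have "(LINT x|lebesgue_on \<Omega>. f x * d x) = (LINT x|lborel. f x * d x)"
      using out \<Omega> by (intro integral_lebesgue_on_eq_lborel) auto
    moreover have "(LINT x|lebesgue_on \<Omega>. (g x \<bullet> i) * \<phi> x) = (LINT x|lborel. (g x \<bullet> i) * \<phi> x)"
      using out \<Omega> by (intro integral_lebesgue_on_eq_lborel) auto
    ultimately show ?thesis by (simp add: d_def)
  qed
  then show "weak_gradient \<Omega> f g"
    using fi gi by (auto simp: weak_gradient_def locally_integrable_def lmeasurable_compact
        intro!: integrable_lborel_imp_lebesgue_on fmeasurableD)
qed

section \<open>Sums, soft maxima and balls\<close>

lemma cutoff_scaled_sum:
  fixes f :: "'i \<Rightarrow> 'a::euclidean_space \<Rightarrow> real"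
  assumes I: "finite I" "\<And>i. i \<in> I \<Longrightarrow> cutoff_with_gradient \<Omega> (f i) (g i)" and a: "0 \<le> a"
  shows "cutoff_with_gradient \<Omega> (\<lambda>x. a * (\<Sum>i\<in>I. f i x)) (\<lambda>x. a *\<^sub>R (\<Sum>i\<in>I. g i x))"
  unfolding cutoff_with_gradient_def
proof (intro conjI allI)
  fix x
  have "(f i has_derivative (\<lambda>h. g i x \<bullet> h)) (at x)" if "i \<in> I" for i
    using I(2)[OF that] by (auto simp: cutoff_with_gradient_def)
  then have "((\<lambda>x. a * (\<Sum>i\<in>I. f i x)) has_derivative (\<lambda>h. a * (\<Sum>i\<in>I. g i x \<bullet> h))) (at x)"
    by (intro has_derivative_mult_right has_derivative_sum) auto
  then show "((\<lambda>x. a * (\<Sum>i\<in>I. f i x)) has_derivative (\<lambda>h. a *\<^sub>R (\<Sum>i\<in>I. g i x) \<bullet> h)) (at x)"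
    by (simp add: inner_sum_left)
  show "0 \<le> a * (\<Sum>i\<in>I. f i x)"
    using I a by (intro mult_nonneg_nonneg sum_nonneg) (auto simp: cutoff_with_gradient_def)
next
  have "\<forall>i\<in>I. \<exists>L. \<forall>x. norm (g i x) \<le> L"
    using I(2) by (auto simp: cutoff_with_gradient_def bounded_iff)
  then obtain L where L: "\<And>i x. i \<in> I \<Longrightarrow> norm (g i x) \<le> L i" by metis
  have "norm (a *\<^sub>R (\<Sum>i\<in>I. g i x)) \<le> a * (\<Sum>i\<in>I. L i)" for x
    using a L by (auto intro!: mult_left_mono sum_norm_le)
  then show "bounded (range (\<lambda>x. a *\<^sub>R (\<Sum>i\<in>I. g i x)))" by (auto simp: bounded_iff)
  have "\<forall>i\<in>I. \<exists>K. compact K \<and> K \<subseteq> \<Omega> \<and> (\<forall>x. x \<notin> K \<longrightarrow> f i x = 0)"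
    using I(2) by (auto simp: cutoff_with_gradient_def)
  then obtain K where K: "\<And>i. i \<in> I \<Longrightarrow> compact (K i) \<and> K i \<subseteq> \<Omega> \<and> (\<forall>x. x \<notin> K i \<longrightarrow> f i x = 0)"
    by metis
  show "\<exists>K. compact K \<and> K \<subseteq> \<Omega> \<and> (\<forall>x. x \<notin> K \<longrightarrow> a * (\<Sum>i\<in>I. f i x) = 0)"
    using K I(1) by (intro exI[of _ "\<Union>i\<in>I. K i"]) (auto intro!: compact_UN)
qed

text \<open>A differentiable substitute for the maximum of finitely many cutoffs \<open>u j\<close>. With \<open>M\<close> the number
  of functions, \<open>ln ((\<Sum>j. exp (s * u j x)) / M) / s\<close> lies between \<open>Max u - ln M / s\<close> and \<open>Max u\<close>, vanishes
  where all \<open>u j\<close> do, and its gradient is a convex combination of the gradients of the \<open>u j\<close>. The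
  gradient is therefore bounded by the largest of them, not by their sum, however many functions there
  are. Choosing \<open>s\<close> large and multiplying by 2 repairs the loss \<open>ln M / s\<close> in the values.\<close>

lemma cutoff_soft_max:
  fixes u :: "'i \<Rightarrow> 'a::euclidean_space \<Rightarrow> real"
  assumes J: "finite J" and uv: "\<And>j. j \<in> J \<Longrightarrow> cutoff_with_gradient \<Omega> (u j) (v j)"
  obtains f g where "cutoff_with_gradient \<Omega> f g"
    "\<And>j x. j \<in> J \<Longrightarrow> 1 \<le> u j x \<Longrightarrow> 1 \<le> f x"
    "\<And>x. g x \<noteq> 0 \<Longrightarrow> \<exists>j\<in>J. norm (g x) \<le> 2 * norm (v j x)"
proof (cases "J = {}")
  case True
  show ?thesis
    by (rule that[of "\<lambda>_. 0" "\<lambda>_. 0"]) (auto simp: True cutoff_with_gradient_def intro: exI[of _ "{}"])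
next
  case False
  define M where "M = real (card J)"
  have M: "M \<ge> 1" using J False by (simp add: M_def card_gt_0_iff Suc_leI)
  \<comment> \<open>The loss \<open>ln M / s\<close> is below \<open>1 / 2\<close>, which the factor 2 in \<open>f\<close> compensates.\<close>
  define s where "s = 2 * ln M + 1"
  have s: "s > 0" using M by (simp add: s_def ln_ge_zero add_nonneg_pos)
  define A where "A x = (\<Sum>j\<in>J. exp (s * u j x))" for x
  define f where "f x = 2 / s * (ln (A x) - ln M)" for x
  define g where "g x = 2 *\<^sub>R (\<Sum>j\<in>J. (exp (s * u j x) / A x) *\<^sub>R v j x)" for x
  have u0: "0 \<le> u j x" if "j \<in> J" for j x
    using uv[OF that] by (auto simp: cutoff_with_gradient_def)
  have AM: "A x \<ge> M" for x
  proof -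
    have "(\<Sum>j\<in>J. 1) \<le> A x"
      unfolding A_def using u0 s by (intro sum_mono) auto
    then show ?thesis by (simp add: M_def)
  qed
  have Apos: "A x > 0" for x using AM[of x] M by linarith
  have der: "(f has_derivative (\<lambda>h. g x \<bullet> h)) (at x)" for x
  proof -
    have "(u j has_derivative (\<lambda>h. v j x \<bullet> h)) (at x)" if "j \<in> J" for j
      using uv[OF that] by (auto simp: cutoff_with_gradient_def)
    then have "(A has_derivative (\<lambda>h. \<Sum>j\<in>J. (s * (v j x \<bullet> h)) * exp (s * u j x))) (at x)"
      unfolding A_def by (auto intro!: derivative_eq_intros)
    then have "(f has_derivative (\<lambda>h. 2 / s * ((\<Sum>j\<in>J. (s * (v j x \<bullet> h)) * exp (s * u j x)) * inverse (A x)))) (at x)"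
      unfolding f_def using Apos[of x] s by (auto intro!: derivative_eq_intros simp: field_simps)
    moreover have "2 / s * ((\<Sum>j\<in>J. (s * (v j x \<bullet> h)) * exp (s * u j x)) * inverse (A x)) = g x \<bullet> h" for h
    proof -
      have "(\<Sum>j\<in>J. (s * (v j x \<bullet> h)) * exp (s * u j x)) = s * (\<Sum>j\<in>J. exp (s * u j x) * (v j x \<bullet> h))"
        by (simp add: sum_distrib_left algebra_simps)
      moreover have "g x \<bullet> h = 2 * ((\<Sum>j\<in>J. exp (s * u j x) * (v j x \<bullet> h)) / A x)"
        by (simp add: g_def inner_sum_left sum_divide_distrib)
      ultimately show ?thesis using s by (simp add: divide_inverse)
    qed
    ultimately show ?thesis by simp
  qed
  have gle: "\<exists>j\<in>J. norm (g x) \<le> 2 * norm (v j x)" for x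
  proof -
    obtain k where k: "k \<in> J" "\<And>j. j \<in> J \<Longrightarrow> norm (v j x) \<le> norm (v k x)"
    proof -
      have "Max ((\<lambda>j. norm (v j x)) ` J) \<in> (\<lambda>j. norm (v j x)) ` J"
        using J False by (intro Max_in) auto
      then obtain k where k: "k \<in> J" "norm (v k x) = Max ((\<lambda>j. norm (v j x)) ` J)" by force
      show ?thesis by (rule that[OF k(1)]) (use k J in auto)
    qed
    have "norm (\<Sum>j\<in>J. (exp (s * u j x) / A x) *\<^sub>R v j x) \<le> (\<Sum>j\<in>J. exp (s * u j x) / A x * norm (v k x))"
      using k Apos[of x] by (intro sum_norm_le) (auto intro!: mult_left_mono divide_right_mono)
    also have "\<dots> = (\<Sum>j\<in>J. exp (s * u j x)) / A x * norm (v k x)"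
      by (simp add: sum_distrib_right sum_divide_distrib)
    also have "\<dots> = norm (v k x)" using Apos[of x] by (simp add: A_def)
    finally show ?thesis using k(1) by (auto simp: g_def)
  qed
  have ge1: "1 \<le> f x" if "j \<in> J" "1 \<le> u j x" for j x
  proof -
    have "exp (s * u j x) \<le> A x"
      unfolding A_def using J that(1) by (intro member_le_sum) auto
    then have "s * u j x \<le> ln (A x)" using Apos[of x] by (simp add: ln_ge_iff)
    moreover have "s * 1 \<le> s * u j x" using that s by (intro mult_left_mono) auto
    ultimately have "s / 2 \<le> ln (A x) - ln M" using s_def by simp
    then show ?thesis using s by (simp add: f_def field_simps)
  qed
  have "cutoff_with_gradient \<Omega> f g"
    unfolding cutoff_with_gradient_def
  proof (intro conjI allI)
    fix x show "(f has_derivative (\<lambda>h. g x \<bullet> h)) (at x)" by (rule der)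
    show "0 \<le> f x" using AM[of x] M s by (auto simp: f_def intro!: divide_nonneg_nonneg)
  next
    have "\<forall>i\<in>J. \<exists>L. \<forall>x. norm (v i x) \<le> L"
      using uv by (auto simp: cutoff_with_gradient_def bounded_iff)
    then obtain L where L: "\<And>i x. i \<in> J \<Longrightarrow> norm (v i x) \<le> L i" by metis
    have L0: "0 \<le> L i" if "i \<in> J" for i using L[OF that, of undefined] norm_ge_zero order_trans by blast
    have "norm (g x) \<le> 2 * (\<Sum>i\<in>J. L i)" for x
    proof -
      obtain j where j: "j \<in> J" "norm (g x) \<le> 2 * norm (v j x)" using gle by blast
      have "norm (v j x) \<le> (\<Sum>i\<in>J. L i)"
        using L[OF j(1), of x] member_le_sum[OF j(1), of L] L0 J by force
      then show ?thesis using j(2) by linarith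
    qed
    then show "bounded (range g)" by (auto simp: bounded_iff)
    have "\<forall>i\<in>J. \<exists>K. compact K \<and> K \<subseteq> \<Omega> \<and> (\<forall>x. x \<notin> K \<longrightarrow> u i x = 0)"
      using uv by (auto simp: cutoff_with_gradient_def)
    then obtain K where K: "\<And>i. i \<in> J \<Longrightarrow> compact (K i) \<and> K i \<subseteq> \<Omega> \<and> (\<forall>x. x \<notin> K i \<longrightarrow> u i x = 0)"
      by metis
    show "\<exists>K. compact K \<and> K \<subseteq> \<Omega> \<and> (\<forall>x. x \<notin> K \<longrightarrow> f x = 0)"
      using K J by (intro exI[of _ "\<Union>i\<in>J. K i"]) (auto intro!: compact_UN simp: f_def A_def M_def)
  qed
  then show ?thesis using that ge1 gle by blast
qed

lemma has_real_derivative_positive_part_square: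
  "((\<lambda>t. (max 0 t)\<^sup>2) has_real_derivative 2 * max 0 t) (at (t::real))"
proof (cases t "0::real" rule: linorder_cases)
  case less
  have "((\<lambda>t. 0::real) has_real_derivative 2 * max 0 t) (at t)" using less by simp
  then show ?thesis
    by (rule has_field_derivative_transform_within_open[where S="{..<0}"]) (use less in auto)
next
  case greater
  have "((\<lambda>t. t\<^sup>2) has_real_derivative 2 * max 0 t) (at t)"
    using greater by (auto intro!: derivative_eq_intros)
  then show ?thesis
    by (rule has_field_derivative_transform_within_open[where S="{0<..}"]) (use greater in auto)
next
  case equal
  have "((\<lambda>h::real. (max 0 h)\<^sup>2 / h) \<longlongrightarrow> 0) (at 0)"
  proof (rule Lim_null_comparison)
    show "\<forall>\<^sub>F h in at 0. norm ((max 0 h)\<^sup>2 / h) \<le> \<bar>h::real\<bar>"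
      by (intro always_eventually) (auto simp: max_def power2_eq_square)
    show "((\<lambda>h::real. \<bar>h\<bar>) \<longlongrightarrow> 0) (at 0)" by (auto intro!: tendsto_eq_intros)
  qed
  then show ?thesis using equal by (simp add: DERIV_def)
qed

text \<open>The profile is a squared positive part, which is differentiable across the boundary of its
  support, so that no separate smoothing is needed.\<close>

lemma cutoff_ball:
  fixes c :: "'a::euclidean_space"
  assumes r: "0 < r" "cball c (2 * r) \<subseteq> \<Omega>"
  obtains f g where "cutoff_with_gradient \<Omega> f g" "\<And>x. x \<in> ball c r \<Longrightarrow> 1 \<le> f x"
    "\<And>x. norm (g x) \<le> 4 / r" "\<And>x. x \<notin> ball c (2 * r) \<Longrightarrow> g x = 0"
proof -
  define w where "w x = 4 - ((x - c) \<bullet> (x - c)) / r\<^sup>2" for x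
  define f where "f x = (max 0 (w x))\<^sup>2 / 9" for x
  define g where "g x = (- 4 / (9 * r\<^sup>2) * max 0 (w x)) *\<^sub>R (x - c)" for x
  have w: "w x = 4 - (dist c x / r)\<^sup>2" for x
    by (simp add: w_def dist_norm norm_minus_commute[of c x] power2_norm_eq_inner power_divide)
  have w_in: "w x \<ge> 3" if "x \<in> ball c r" for x
  proof -
    have "(dist c x / r)\<^sup>2 \<le> 1\<^sup>2" using that r by (intro power_mono) auto
    then show ?thesis by (simp add: w)
  qed
  have w_out: "w x \<le> 0" if "x \<notin> ball c (2 * r)" for x
  proof -
    have "2\<^sup>2 \<le> (dist c x / r)\<^sup>2" using that r by (intro power_mono) (auto simp: field_simps)
    then show ?thesis by (simp add: w)
  qed
  have der: "(f has_derivative (\<lambda>h. g x \<bullet> h)) (at x)" for x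
  proof -
    have "(w has_derivative (\<lambda>h. - (2 * ((x - c) \<bullet> h)) / r\<^sup>2)) (at x)"
      unfolding w_def using r
      by (auto intro!: derivative_eq_intros simp: inner_commute fun_eq_iff power2_eq_square power4_eq_xxxx)
    from has_derivative_compose[OF this has_real_derivative_positive_part_square[of "w x", unfolded has_field_derivative_def]]
    have "((\<lambda>x. (max 0 (w x))\<^sup>2) has_derivative (\<lambda>h. 2 * max 0 (w x) * (- (2 * ((x - c) \<bullet> h)) / r\<^sup>2))) (at x)" .
    then have "(f has_derivative (\<lambda>h. (2 * max 0 (w x) * (- (2 * ((x - c) \<bullet> h)) / r\<^sup>2)) / 9)) (at x)"
      unfolding f_def using has_derivative_mult_left[of _ _ _ "1 / 9"] by fastforce
    moreover have "(2 * max 0 (w x) * (- (2 * ((x - c) \<bullet> h)) / r\<^sup>2)) / 9 = g x \<bullet> h" for h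
    proof -
      have "g x \<bullet> h = - 4 / (9 * r\<^sup>2) * max 0 (w x) * ((x - c) \<bullet> h)" by (simp add: g_def)
      then show ?thesis by (simp only:) (simp add: divide_simps)
    qed
    ultimately show ?thesis by simp
  qed
  have g_out: "g x = 0" if "x \<notin> ball c (2 * r)" for x using w_out[OF that] by (simp add: g_def)
  have g_le: "norm (g x) \<le> 4 / r" for x
  proof (cases "x \<in> ball c (2 * r)")
    case True
    have "norm (g x) = 4 / (9 * r\<^sup>2) * max 0 (w x) * dist c x"
      by (simp add: g_def dist_norm norm_minus_commute abs_mult)
    also have "\<dots> \<le> 4 / (9 * r\<^sup>2) * 4 * (2 * r)"
      using True r by (intro mult_mono) (auto simp: w)
    also have "\<dots> = (32/9) / r" using r by (simp add: power2_eq_square field_simps)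
    also have "\<dots> \<le> 4 / r" using r by (intro divide_right_mono) auto
    finally show ?thesis .
  qed (use g_out r in auto)
  have f1: "1 \<le> f x" if "x \<in> ball c r" for x
    using power_mono[OF w_in[OF that], of 2] w_in[OF that] by (simp add: f_def)
  have "cutoff_with_gradient \<Omega> f g"
    unfolding cutoff_with_gradient_def
  proof (intro conjI allI)
    show "bounded (range g)" using g_le by (auto simp: bounded_iff)
    show "\<exists>K. compact K \<and> K \<subseteq> \<Omega> \<and> (\<forall>x. x \<notin> K \<longrightarrow> f x = 0)"
      using r w_out by (intro exI[of _ "cball c (2 * r)"]) (auto simp: f_def)
  qed (use der in \<open>auto simp: f_def\<close>)
  then show ?thesis using that f1 g_le g_out by blast
qed

section \<open>The growth function: cutoffs and balls\<close>

lemma powr_quotient_bound: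
  fixes A B s t e c :: real
  assumes "A / s powr e \<le> c * (B / t powr e)" "0 < s" "0 < t"
  shows "A \<le> c * (s / t) powr e * B"
  using assms by (simp add: powr_divide field_simps)

locale growth_function =
  fixes \<Omega> :: "'a::euclidean_space set" and \<Phi> :: "'a \<Rightarrow> real \<Rightarrow> real" and m :: "'a \<Rightarrow> real"
    and C\<^sub>1 \<beta>\<^sub>3 \<beta>\<^sub>4 c\<^sub>d c\<^sub>g p q :: real
  assumes open_domain: "open \<Omega>"
    and caratheodory: "caratheodory \<Omega> \<Phi>"
    and \<Phi>_0: "x \<in> \<Omega> \<Longrightarrow> \<Phi> x 0 = 0"
    and m_locally_integrable: "locally_integrable \<Omega> m"
    and \<Phi>_le_m: "1 \<le> t \<Longrightarrow> AE x in lebesgue_on \<Omega>. \<Phi> x t \<le> C\<^sub>1 * (m x * t ^ DIM('a))"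
    and \<beta>\<^sub>3: "0 < \<beta>\<^sub>3"
    and \<Phi>_ge_1: "x \<in> \<Omega> \<Longrightarrow> 1 \<le> \<Phi> x (1 / \<beta>\<^sub>3)"
    and \<beta>\<^sub>4: "0 < \<beta>\<^sub>4" "\<beta>\<^sub>4 \<le> 1"
    and c\<^sub>d: "1 \<le> c\<^sub>d"
    and esssup_le_essinf: "\<lbrakk>0 < r; r \<le> 1; ball c r \<subseteq> \<Omega>; 1 \<le> t; t \<le> 1 / r\<rbrakk> \<Longrightarrow>
      esssup (lebesgue_on (ball c r)) (\<lambda>x. ereal (\<Phi> x (\<beta>\<^sub>4 * t)))
        \<le> ereal c\<^sub>d * essinf (lebesgue_on (ball c r)) (\<lambda>x. ereal (\<Phi> x t))"
    and exponents: "1 < p" "1 \<le> c\<^sub>g"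
    and lower_growth: "\<lbrakk>x \<in> \<Omega>; 0 < s; s \<le> t\<rbrakk> \<Longrightarrow> \<Phi> x s / s powr p \<le> c\<^sub>g * (\<Phi> x t / t powr p)"
    and upper_growth: "\<lbrakk>x \<in> \<Omega>; 0 < s; s \<le> t\<rbrakk> \<Longrightarrow> \<Phi> x t / t powr q \<le> c\<^sub>g * (\<Phi> x s / s powr q)"
begin

lemma domain_measurable [measurable, simp]: "\<Omega> \<in> sets lebesgue"
  using open_domain by simp

lemma \<Phi>_nonneg: "x \<in> \<Omega> \<Longrightarrow> 0 \<le> t \<Longrightarrow> 0 \<le> \<Phi> x t"
  using caratheodory by (auto simp: caratheodory_def)

lemma \<Phi>_measurable [measurable]: "0 \<le> t \<Longrightarrow> (\<lambda>x. \<Phi> x t) \<in> borel_measurable (lebesgue_on \<Omega>)"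
  using caratheodory by (auto simp: caratheodory_def)

lemma AE_continuous_mono:
  "AE x in lebesgue_on \<Omega>. x \<in> \<Omega> \<and> continuous_on {0..} (\<Phi> x) \<and> mono_on {0..} (\<Phi> x)"
proof -
  have "AE x in lebesgue_on \<Omega>. x \<in> \<Omega>" by (rule AE_I2) simp
  then show ?thesis using caratheodory by (auto simp: caratheodory_def)
qed

lemma \<Phi>_scale_le_1:
  assumes x: "x \<in> \<Omega>" and "0 \<le> a" "a \<le> 1" "0 \<le> t"
  shows "\<Phi> x (a * t) \<le> c\<^sub>g * a powr p * \<Phi> x t"
proof (cases "a = 0 \<or> t = 0")
  case True
  then show ?thesis using \<Phi>_0[OF x] by auto
next
  case False
  then have pos: "0 < a" "0 < t" using assms by auto
  then have "a * t \<le> t" using assms(3) by (simp add: mult_le_cancel_right1)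
  then show ?thesis
    using powr_quotient_bound[OF lower_growth[OF x, of "a * t" t]] pos by simp
qed

lemma \<Phi>_scale_ge_1:
  assumes x: "x \<in> \<Omega>" and "1 \<le> a" "0 \<le> t"
  shows "\<Phi> x (a * t) \<le> c\<^sub>g * a powr q * \<Phi> x t"
proof (cases "t = 0")
  case True
  then show ?thesis using \<Phi>_0[OF x] by auto
next
  case False
  then have pos: "0 < a" "0 < t" using assms by auto
  then have "t \<le> a * t" using assms(2) by (simp add: mult_le_cancel_right1)
  then show ?thesis
    using powr_quotient_bound[OF upper_growth[OF x, of t "a * t"]] pos by simp
qed

text \<open>Caratheodory functions preserve measurability under composition: \<open>h\<close> is the limit of functions
  with countably many values, and \<open>\<Phi> x\<close> is continuous for almost every \<open>x\<close>. Completeness of Lebesgue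
  measure absorbs the exceptional null set.\<close>

lemma \<Phi>_compose_measurable:
  assumes [measurable]: "h \<in> borel_measurable (lebesgue_on \<Omega>)" and h0: "\<And>x. 0 \<le> h x"
  shows "(\<lambda>x. \<Phi> x (h x)) \<in> borel_measurable (lebesgue_on \<Omega>)"
proof -
  define F where "F n x = \<Phi> x (real (nat \<lfloor>real (Suc n) * h x\<rfloor>) / real (Suc n))" for n x
  have F: "F n \<in> borel_measurable (lebesgue_on \<Omega>)" for n
    unfolding F_def by (rule measurable_compose_countable[where f="\<lambda>k x. \<Phi> x (real k / real (Suc n))"]) auto
  have lim: "(\<lambda>n. F n x) \<longlonglongrightarrow> \<Phi> x (h x)" if "continuous_on {0..} (\<Phi> x)" for x
  proof -
    have "(\<lambda>n. real (nat \<lfloor>real (Suc n) * h x\<rfloor>) / real (Suc n)) \<longlonglongrightarrow> h x"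
    proof (rule real_tendsto_sandwich)
      have "h x - 1 / real (Suc n) \<le> real (nat \<lfloor>real (Suc n) * h x\<rfloor>) / real (Suc n)
         \<and> real (nat \<lfloor>real (Suc n) * h x\<rfloor>) / real (Suc n) \<le> h x" for n
      proof -
        define N where "N = real (Suc n)"
        have N: "N > 0" "0 \<le> N * h x" using h0 by (auto simp: N_def)
        define k where "k = real (nat \<lfloor>N * h x\<rfloor>)"
        have k: "N * h x - 1 \<le> k" "k \<le> N * h x"
          unfolding k_def using N(2) by linarith+
        have "(N * h x - 1) / N \<le> k / N" by (rule divide_right_mono[OF k(1)]) (use N in simp)
        moreover have "(N * h x - 1) / N = h x - 1 / N" using N by (simp add: diff_divide_distrib)
        moreover have "k / N \<le> h x" using k(2) N(1) by (simp add: pos_divide_le_eq mult.commute)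
        ultimately show ?thesis unfolding N_def[symmetric] k_def[symmetric] by simp
      qed
      then show "\<forall>\<^sub>F n in sequentially. h x - 1 / real (Suc n) \<le> real (nat \<lfloor>real (Suc n) * h x\<rfloor>) / real (Suc n)"
        "\<forall>\<^sub>F n in sequentially. real (nat \<lfloor>real (Suc n) * h x\<rfloor>) / real (Suc n) \<le> h x" by auto
      show "(\<lambda>n. h x - 1 / real (Suc n)) \<longlonglongrightarrow> h x"
        using tendsto_diff[OF tendsto_const LIMSEQ_Suc[OF lim_inverse_n'], of "h x"] by simp
    qed simp
    then show ?thesis unfolding F_def
      by (rule continuous_on_tendsto_compose[OF that]) (use h0 in auto)
  qed
  obtain N where N: "N \<in> null_sets (lebesgue_on \<Omega>)"
    "\<And>x. x \<in> \<Omega> \<Longrightarrow> x \<notin> N \<Longrightarrow> continuous_on {0..} (\<Phi> x)"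
  proof -
    obtain N where "N \<in> null_sets (lebesgue_on \<Omega>)"
      "\<And>x. x \<in> space (lebesgue_on \<Omega>) - N \<Longrightarrow> x \<in> \<Omega> \<and> continuous_on {0..} (\<Phi> x) \<and> mono_on {0..} (\<Phi> x)"
      using AE_E3[OF AE_continuous_mono] by metis
    then show ?thesis using that[of N] by simp
  qed
  have Ns [measurable]: "N \<in> sets (lebesgue_on \<Omega>)" using N(1) by auto
  have "(\<lambda>x. if x \<in> N then 0 else \<Phi> x (h x)) \<in> borel_measurable (lebesgue_on \<Omega>)"
  proof (rule borel_measurable_LIMSEQ_real)
    show "(\<lambda>n. if x \<in> N then 0 else F n x) \<longlonglongrightarrow> (if x \<in> N then 0 else \<Phi> x (h x))"
      if "x \<in> space (lebesgue_on \<Omega>)" for x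
      using that N(2) lim by auto
    show "(\<lambda>x. if x \<in> N then 0 else F n x) \<in> borel_measurable (lebesgue_on \<Omega>)" for n
      using F[of n] by measurable
  qed
  then have "(\<lambda>x. indicator \<Omega> x *\<^sub>R (if x \<in> N then 0 else \<Phi> x (h x))) \<in> borel_measurable lebesgue"
    by (subst borel_measurable_restrict_space_iff[symmetric]) auto
  moreover have "AE x in lebesgue. indicator \<Omega> x *\<^sub>R (if x \<in> N then 0 else \<Phi> x (h x)) = indicator \<Omega> x *\<^sub>R \<Phi> x (h x)"
  proof -
    have "N \<in> null_sets lebesgue" using N(1) by (simp add: null_sets_restrict_space)
    from AE_not_in[OF this] show ?thesis by eventually_elim auto
  qed
  ultimately have "(\<lambda>x. indicator \<Omega> x *\<^sub>R \<Phi> x (h x)) \<in> borel_measurable lebesgue"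
    by (rule borel_measurable_AE)
  then show ?thesis by (subst borel_measurable_restrict_space_iff) auto
qed

text \<open>The locally integrable majorant \<open>C\<^sub>1 m t\<^sup>n\<close> of \<open>\<Phi>\<close> is what places all cutoffs in the Sobolev
  space.\<close>

lemma \<Phi>_bounded_integrable:
  assumes h: "h \<in> borel_measurable (lebesgue_on \<Omega>)" and h0: "\<And>x. 0 \<le> h x" and hM: "\<And>x. h x \<le> M"
    and K: "compact K" "K \<subseteq> \<Omega>" "\<And>x. x \<notin> K \<Longrightarrow> h x = 0"
  shows "integrable (lebesgue_on \<Omega>) (\<lambda>x. \<Phi> x (h x))"
proof (rule Bochner_Integration.integrable_bound)
  define T where "T = max M 1"
  have Ks: "K \<in> sets lebesgue" using K(1) by (simp add: fmeasurableD lmeasurable_compact)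
  have "integrable (lebesgue_on K) m"
    using m_locally_integrable K by (auto simp: locally_integrable_def)
  then have "integrable lebesgue (\<lambda>x. indicator K x *\<^sub>R m x)"
    using Ks by (simp add: integrable_restrict_space)
  then have "integrable lebesgue (\<lambda>x. indicator \<Omega> x *\<^sub>R (indicator K x *\<^sub>R m x))"
    by (rule integrable_mult_indicator[rotated]) simp
  then have "integrable (lebesgue_on \<Omega>) (\<lambda>x. indicator K x *\<^sub>R m x)"
    by (simp add: integrable_restrict_space)
  then show "integrable (lebesgue_on \<Omega>) (\<lambda>x. C\<^sub>1 * T ^ DIM('a) * (indicator K x *\<^sub>R m x))"
    by (rule integrable_mult_right)
  show "(\<lambda>x. \<Phi> x (h x)) \<in> borel_measurable (lebesgue_on \<Omega>)"
    using h h0 by (rule \<Phi>_compose_measurable)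
  have "1 \<le> T" by (simp add: T_def)
  from \<Phi>_le_m[OF this] AE_continuous_mono
  show "AE x in lebesgue_on \<Omega>. norm (\<Phi> x (h x)) \<le> norm (C\<^sub>1 * T ^ DIM('a) * (indicator K x *\<^sub>R m x))"
  proof eventually_elim
    case (elim x)
    show ?case
    proof (cases "x \<in> K")
      case True
      have "\<Phi> x (h x) \<le> \<Phi> x T"
        using elim(2) h0[of x] hM[of x] by (intro mono_onD[of "{0..}" "\<Phi> x"]) (auto simp: T_def)
      then have "\<bar>\<Phi> x (h x)\<bar> \<le> C\<^sub>1 * (m x * T ^ DIM('a))"
        using elim \<Phi>_nonneg[of x "h x"] h0 by simp
      then show ?thesis using True by (simp add: algebra_simps)
    next
      case False then show ?thesis using K \<Phi>_0 elim by simp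
    qed
  qed
qed

lemma cutoff_in_W1Phi_C0:
  assumes c: "cutoff_with_gradient \<Omega> f g"
  shows "f \<in> W1Phi \<Phi> \<Omega>" "f \<in> C0 \<Omega>"
proof -
  obtain K M L where K: "compact K" "K \<subseteq> \<Omega>" "\<And>x. x \<notin> K \<Longrightarrow> f x = 0" "\<And>x. x \<notin> K \<Longrightarrow> g x = 0"
    and bd: "\<And>x. \<bar>f x\<bar> \<le> M" "\<And>x. norm (g x) \<le> L"
    using cutoff_bounds[OF c] by metis
  note wg = cutoff_weak_gradient[OF c open_domain]
  have i: "integrable (lebesgue_on \<Omega>) f" "integrable (lebesgue_on \<Omega>) g"
    using wg by (auto intro: integrable_lborel_imp_lebesgue_on)
  then have [measurable]: "f \<in> borel_measurable (lebesgue_on \<Omega>)" "g \<in> borel_measurable (lebesgue_on \<Omega>)"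
    by auto
  have "integrable (lebesgue_on \<Omega>) (\<lambda>x. \<Phi> x \<bar>f x\<bar>)" "integrable (lebesgue_on \<Omega>) (\<lambda>x. \<Phi> x (norm (g x)))"
    using K bd by (auto intro!: \<Phi>_bounded_integrable[where K=K])
  then show "f \<in> W1Phi \<Phi> \<Omega>"
    using wg(3) i by (auto simp: W1Phi_def W11_def intro!: exI[of _ g])
  have sub: "closure {x \<in> \<Omega>. f x \<noteq> 0} \<subseteq> K"
    using K by (intro closure_minimal) (auto intro: compact_imp_closed)
  then have "compact (closure {x \<in> \<Omega>. f x \<noteq> 0})"
    using K(1) closed_closure by (metis compact_Int_closed inf.absorb_iff2)
  then show "f \<in> C0 \<Omega>"
    using sub K cutoff_continuous[OF c] by (auto simp: C0_def intro: continuous_on_subset)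
qed

lemma Cap_star_le_cutoff_energy:
  assumes c: "cutoff_with_gradient \<Omega> f g" and "\<And>x. x \<in> K \<Longrightarrow> 1 \<le> f x"
  shows "Cap_star \<Phi> \<Omega> K \<le> (\<integral>\<^sup>+x. ennreal (\<Phi> x (norm (g x))) \<partial>lebesgue_on \<Omega>)"
proof -
  have "(f, g) \<in> {(f, g). f \<in> cap_admissible \<Phi> \<Omega> K \<and> weak_gradient \<Omega> f g}"
    using cutoff_in_W1Phi_C0[OF c] cutoff_weak_gradient[OF c open_domain] assms
    by (auto simp: cap_admissible_def cutoff_with_gradient_def)
  then show ?thesis unfolding Cap_star_def by (rule INF_lower2) simp
qed

lemma h_Phi_eq:
  "h_Phi \<Phi> (c, r) = (\<integral>\<^sup>+x. ennreal (\<Phi> x (1 / r)) * indicator (ball c r) x \<partial>lebesgue)"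
  unfolding h_Phi_def by (simp add: nn_integral_restrict_space)

lemma h_Phi_integrand_measurable:
  assumes "0 < r" "ball c r \<subseteq> \<Omega>"
  shows "(\<lambda>x. ennreal (\<Phi> x (1 / r)) * indicator (ball c r) x) \<in> borel_measurable lebesgue"
proof -
  have [measurable]: "ball c r \<in> sets lebesgue" by simp
  have [measurable]: "(\<lambda>x. indicator \<Omega> x *\<^sub>R \<Phi> x (1 / r)) \<in> borel_measurable lebesgue"
    using assms \<Phi>_measurable[of "1 / r"] by (subst borel_measurable_restrict_space_iff[symmetric]) auto
  have "(\<lambda>x. ennreal (indicator \<Omega> x *\<^sub>R \<Phi> x (1 / r)) * indicator (ball c r) x) \<in> borel_measurable lebesgue"
    by measurable
  moreover have "(\<lambda>x. ennreal (\<Phi> x (1 / r)) * indicator (ball c r) x) =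
      (\<lambda>x. ennreal (indicator \<Omega> x *\<^sub>R \<Phi> x (1 / r)) * indicator (ball c r) x)"
    using assms by (auto simp: indicator_def fun_eq_iff)
  ultimately show ?thesis by simp
qed

text \<open>The comparison of essential supremum and infimum on \<open>ball c (2 * r)\<close> makes \<open>\<Phi>\<close> at heights
  proportional to \<open>1 / r\<close> nearly constant there, so enlarging the ball and the height costs only a
  constant factor. The height \<open>8 / r\<close> is the gradient bound \<open>4 / r\<close> of a ball cutoff times the factor 2
  lost by the soft maximum.\<close>

lemma \<Phi>_double_ball_le_h_Phi:
  obtains A where "0 \<le> A" "\<And>c r. 0 < r \<Longrightarrow> 2 * r \<le> 1 \<Longrightarrow> ball c (2 * r) \<subseteq> \<Omega> \<Longrightarrow>
    (\<integral>\<^sup>+x. ennreal (\<Phi> x (8 / r)) * indicator (ball c (2 * r)) x \<partial>lebesgue_on \<Omega>) \<le> ennreal A * h_Phi \<Phi> (c, r)"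
proof -
  define B where "B = c\<^sub>g * (16 / \<beta>\<^sub>4) powr q"
  have B: "0 \<le> B" using exponents by (simp add: B_def)
  show ?thesis
  proof (rule that[of "B * c\<^sub>d * c\<^sub>g * 2 ^ DIM('a)"])
    fix c r assume r: "0 < r" "2 * r \<le> 1" and sub: "ball c (2 * r) \<subseteq> \<Omega>"
    define D where "D = ball c (2 * r)"
    define t where "t = 1 / (2 * r)"
    define e where "e = essinf (lebesgue_on D) (\<lambda>x. ereal (\<Phi> x t))"
    have t: "1 \<le> t" using r by (simp add: t_def field_simps)
    have Ds: "D \<in> sets lebesgue" by (simp add: D_def)
    have bs: "ball c r \<subseteq> D" using r by (auto simp: D_def)
    have "AE x in lebesgue_on D. ereal (\<Phi> x (\<beta>\<^sub>4 * t)) \<le> ereal c\<^sub>d * e"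
      using esssup_AE[of "\<lambda>x. ereal (\<Phi> x (\<beta>\<^sub>4 * t))" "lebesgue_on D"]
    proof eventually_elim
      case (elim x) then show ?case
        using esssup_le_essinf[of "2 * r" c t] r sub t by (auto simp: D_def e_def t_def)
    qed
    then have up: "AE x in lebesgue. x \<in> D \<longrightarrow> ereal (\<Phi> x (\<beta>\<^sub>4 * t)) \<le> ereal c\<^sub>d * e"
      using Ds by (simp add: AE_restrict_space_iff)
    have "AE x in lebesgue_on D. e \<le> ereal (\<Phi> x t)"
      using esssup_AE[of "\<lambda>x. - ereal (\<Phi> x t)" "lebesgue_on D"]
      by eventually_elim (simp add: e_def essinf_def ereal_uminus_le_reorder)
    then have lo: "AE x in lebesgue. x \<in> D \<longrightarrow> e \<le> ereal (\<Phi> x t)"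
      using Ds by (simp add: AE_restrict_space_iff)
    have "\<exists>x\<in>D. ereal (\<Phi> x (\<beta>\<^sub>4 * t)) \<le> ereal c\<^sub>d * e \<and> e \<le> ereal (\<Phi> x t)"
    proof (rule ccontr)
      assume "\<not> ?thesis"
      moreover have "AE x in lebesgue. x \<in> D \<longrightarrow> ereal (\<Phi> x (\<beta>\<^sub>4 * t)) \<le> ereal c\<^sub>d * e \<and> e \<le> ereal (\<Phi> x t)"
        using up lo by eventually_elim auto
      ultimately have "AE x in lebesgue. x \<notin> D" by auto
      then have "D \<in> null_sets lebesgue" using Ds AE_iff_null_sets by blast
      then have "emeasure lebesgue D = 0" by auto
      then have "measure lebesgue D = 0" by (simp add: measure_def)
      then show False using r content_ball_gt_0_iff[of c "2 * r"]
        by (simp add: D_def del: content_ball_gt_0_iff)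
    qed
    then obtain x where x: "x \<in> D" "ereal (\<Phi> x (\<beta>\<^sub>4 * t)) \<le> ereal c\<^sub>d * e" "e \<le> ereal (\<Phi> x t)" by blast
    have "0 \<le> \<Phi> x (\<beta>\<^sub>4 * t)" using x sub \<beta>\<^sub>4 t by (intro \<Phi>_nonneg) (auto simp: D_def)
    then have "0 \<le> ereal c\<^sub>d * e" using x(2) by (metis ereal_less_eq(5) order_trans)
    then have "0 \<le> e" using c\<^sub>d by (simp add: ereal_zero_le_0_iff)
    then obtain E where E: "e = ereal E" "0 \<le> E" using x(3) by (cases e) auto
    have pt: "\<Phi> x (8 / r) \<le> B * c\<^sub>d * E" if "x \<in> D" "ereal (\<Phi> x (\<beta>\<^sub>4 * t)) \<le> ereal c\<^sub>d * e" for x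
    proof -
      have "\<Phi> x (16 / \<beta>\<^sub>4 * (\<beta>\<^sub>4 * t)) \<le> B * \<Phi> x (\<beta>\<^sub>4 * t)"
        unfolding B_def using that sub \<beta>\<^sub>4 t by (intro \<Phi>_scale_ge_1) (auto simp: D_def field_simps)
      also have "\<dots> \<le> B * (c\<^sub>d * E)" using that B E by (intro mult_left_mono) auto
      finally show ?thesis using \<beta>\<^sub>4 by (simp add: t_def field_simps)
    qed
    have pt2: "E \<le> c\<^sub>g * \<Phi> x (1 / r)" if "x \<in> D" "e \<le> ereal (\<Phi> x t)" for x
    proof -
      have xo: "x \<in> \<Omega>" using that sub by (auto simp: D_def)
      have "E \<le> \<Phi> x (1/2 * (1 / r))" using that E by (simp add: t_def)
      also have "\<dots> \<le> c\<^sub>g * (1/2) powr p * \<Phi> x (1 / r)"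
        using r xo by (intro \<Phi>_scale_le_1) auto
      also have "\<dots> \<le> c\<^sub>g * 1 * \<Phi> x (1 / r)"
        using \<Phi>_nonneg[OF xo, of "1 / r"] r exponents
        by (intro mult_right_mono mult_left_mono) (auto simp: powr_le1)
      finally show ?thesis by simp
    qed
    have "(\<integral>\<^sup>+x. ennreal (\<Phi> x (8 / r)) * indicator D x \<partial>lebesgue_on \<Omega>)
       = (\<integral>\<^sup>+x. ennreal (\<Phi> x (8 / r)) * indicator D x * indicator \<Omega> x \<partial>lebesgue)"
      by (simp add: nn_integral_restrict_space)
    also have "\<dots> \<le> (\<integral>\<^sup>+x. ennreal (B * c\<^sub>d * E) * indicator D x \<partial>lebesgue)"
      using up by (intro nn_integral_mono_AE, eventually_elim)
        (use pt in \<open>auto simp: indicator_def intro!: ennreal_leI\<close>)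
    also have "\<dots> = ennreal (B * c\<^sub>d * E) * emeasure lebesgue D"
      using Ds by (simp add: nn_integral_cmult_indicator)
    also have "emeasure lebesgue D = ennreal (2 ^ DIM('a)) * emeasure lebesgue (ball c r)"
      using r unfolding D_def
      by (subst (1 2) emeasure_lebesgue_ball_conv_unit_ball)
        (auto simp: power_mult_distrib ennreal_mult mult.assoc)
    also have "ennreal (B * c\<^sub>d * E) * (ennreal (2 ^ DIM('a)) * emeasure lebesgue (ball c r))
      = ennreal (B * c\<^sub>d * 2 ^ DIM('a)) * (\<integral>\<^sup>+x. ennreal E * indicator (ball c r) x \<partial>lebesgue)"
      using B c\<^sub>d E by (simp add: nn_integral_cmult_indicator ennreal_mult ac_simps)
    also have "\<dots> \<le> ennreal (B * c\<^sub>d * 2 ^ DIM('a)) * (\<integral>\<^sup>+x. ennreal (c\<^sub>g * \<Phi> x (1 / r)) * indicator (ball c r) x \<partial>lebesgue)"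
      using lo by (intro mult_left_mono nn_integral_mono_AE, eventually_elim)
        (use pt2 bs in \<open>auto simp: indicator_def intro!: ennreal_leI\<close>)
    also have "(\<integral>\<^sup>+x. ennreal (c\<^sub>g * \<Phi> x (1 / r)) * indicator (ball c r) x \<partial>lebesgue) = ennreal c\<^sub>g * h_Phi \<Phi> (c, r)"
    proof -
      have bs': "ball c r \<subseteq> \<Omega>" using bs sub by (auto simp: D_def)
      have "(\<integral>\<^sup>+x. ennreal (c\<^sub>g * \<Phi> x (1 / r)) * indicator (ball c r) x \<partial>lebesgue)
         = (\<integral>\<^sup>+x. ennreal c\<^sub>g * (ennreal (\<Phi> x (1 / r)) * indicator (ball c r) x) \<partial>lebesgue)"
        using exponents by (intro nn_integral_cong) (auto simp: ennreal_mult' ac_simps)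
      also have "\<dots> = ennreal c\<^sub>g * h_Phi \<Phi> (c, r)"
        unfolding h_Phi_eq using r bs' by (intro nn_integral_cmult h_Phi_integrand_measurable)
      finally show ?thesis .
    qed
    finally show "(\<integral>\<^sup>+x. ennreal (\<Phi> x (8 / r)) * indicator (ball c (2 * r)) x \<partial>lebesgue_on \<Omega>)
        \<le> ennreal (B * c\<^sub>d * c\<^sub>g * 2 ^ DIM('a)) * h_Phi \<Phi> (c, r)"
      using B c\<^sub>d exponents by (simp add: D_def ennreal_mult ac_simps)
  qed (use B c\<^sub>d exponents in simp)
qed

text \<open>Since \<open>\<Phi> x (1 / \<beta>\<^sub>3) \<ge> 1\<close> and \<open>\<Phi>\<close> grows at least linearly, \<open>\<Phi> x (1 / r)\<close> is at least of order
  \<open>1 / r\<close>. Small balls thus have a volume that is small compared with their Hausdorff premeasure.\<close>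

lemma emeasure_double_ball_le_h_Phi:
  assumes r: "0 < r" "r \<le> \<beta>\<^sub>3" "r \<le> \<kappa>" and sub: "ball c r \<subseteq> \<Omega>"
  shows "emeasure lebesgue (ball c (2 * r)) \<le> ennreal (2 ^ DIM('a) * c\<^sub>g / \<beta>\<^sub>3 * \<kappa>) * h_Phi \<Phi> (c, r)"
proof -
  have pt: "1 \<le> c\<^sub>g / \<beta>\<^sub>3 * \<kappa> * \<Phi> x (1 / r)" if "x \<in> ball c r" for x
  proof -
    have x: "x \<in> \<Omega>" using that sub by auto
    have "1 \<le> \<Phi> x (1 / \<beta>\<^sub>3)" using x by (rule \<Phi>_ge_1)
    also have "\<dots> = \<Phi> x ((r / \<beta>\<^sub>3) * (1 / r))" using r by simp
    also have "\<dots> \<le> c\<^sub>g * (r / \<beta>\<^sub>3) powr p * \<Phi> x (1 / r)"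
      using x r \<beta>\<^sub>3 by (intro \<Phi>_scale_le_1) auto
    also have "\<dots> \<le> c\<^sub>g * (r / \<beta>\<^sub>3) powr 1 * \<Phi> x (1 / r)"
      using \<Phi>_nonneg[OF x, of "1 / r"] r \<beta>\<^sub>3 exponents
      by (intro mult_right_mono mult_left_mono powr_mono') auto
    also have "\<dots> \<le> c\<^sub>g * (\<kappa> / \<beta>\<^sub>3) * \<Phi> x (1 / r)"
      using \<Phi>_nonneg[OF x, of "1 / r"] r \<beta>\<^sub>3 exponents
      by (intro mult_right_mono mult_left_mono) (auto intro: divide_right_mono)
    finally show ?thesis by (simp add: field_simps)
  qed
  define A where "A = c\<^sub>g / \<beta>\<^sub>3 * \<kappa>"
  have A: "A \<ge> 0" using r \<beta>\<^sub>3 exponents by (simp add: A_def)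
  have "emeasure lebesgue (ball c (2 * r)) = ennreal (2 ^ DIM('a)) * emeasure lebesgue (ball c r)"
    using r by (subst (1 2) emeasure_lebesgue_ball_conv_unit_ball)
      (auto simp: power_mult_distrib ennreal_mult mult.assoc)
  also have "emeasure lebesgue (ball c r) = (\<integral>\<^sup>+x. indicator (ball c r) x \<partial>lebesgue)" by simp
  also have "\<dots> \<le> (\<integral>\<^sup>+x. ennreal A * (ennreal (\<Phi> x (1 / r)) * indicator (ball c r) x) \<partial>lebesgue)"
  proof (intro nn_integral_mono)
    fix x show "indicator (ball c r) x \<le> ennreal A * (ennreal (\<Phi> x (1 / r)) * indicator (ball c r) x)"
    proof (cases "x \<in> ball c r")
      case True
      have "ennreal 1 \<le> ennreal (A * \<Phi> x (1 / r))" using pt[OF True] unfolding A_def by (rule ennreal_leI)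
      then show ?thesis using True A by (simp add: ennreal_mult')
    qed simp
  qed
  also have "\<dots> = ennreal A * h_Phi \<Phi> (c, r)"
    unfolding h_Phi_eq using r sub by (intro nn_integral_cmult h_Phi_integrand_measurable)
  also have "ennreal (2 ^ DIM('a)) * (ennreal A * h_Phi \<Phi> (c, r)) = ennreal (2 ^ DIM('a) * A) * h_Phi \<Phi> (c, r)"
    using A by (simp add: ennreal_mult ac_simps)
  finally show ?thesis by (simp add: A_def mult_left_mono mult.assoc)
qed

end

section \<open>Ball covers give uniformly controlled cutoffs\<close>

text \<open>Truncating \<open>G\<close> at a high level loses little of the integral, and the truncated function has a
  small integral over every set of small measure.\<close>

lemma nn_integral_absolute_continuity:
  assumes [measurable]: "G \<in> borel_measurable M" and fin: "(\<integral>\<^sup>+x. G x \<partial>M) < \<infinity>" and "0 < (\<epsilon>::real)"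
  obtains \<delta> :: real where "0 < \<delta>"
    "\<And>A. A \<in> sets M \<Longrightarrow> emeasure M A \<le> ennreal \<delta> \<Longrightarrow> (\<integral>\<^sup>+x. G x * indicator A x \<partial>M) \<le> ennreal \<epsilon>"
proof -
  define F where "F n x = min (G x) (of_nat n)" for n x
  have Fm [measurable]: "F n \<in> borel_measurable M" for n unfolding F_def by measurable
  have FG: "F n x \<le> G x" for n x by (simp add: F_def)
  have "(SUP n. F n x) = G x" for x
  proof -
    have "(SUP n. F n x) = (SUP n. inf (G x) (of_nat n))" by (simp add: F_def inf_min)
    also have "\<dots> = inf (G x) (SUP n. of_nat n)" by (simp add: inf_SUP)
    finally show ?thesis by (simp add: ennreal_SUP_of_nat_eq_top)
  qed
  moreover have "(\<integral>\<^sup>+x. (SUP n. F n x) \<partial>M) = (SUP n. \<integral>\<^sup>+x. F n x \<partial>M)"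
    by (rule nn_integral_monotone_convergence_SUP)
      (auto simp: incseq_def le_fun_def F_def min_le_iff_disj le_max_iff_disj intro: min.coboundedI2)
  ultimately have SUP: "(\<integral>\<^sup>+x. G x \<partial>M) = (SUP n. \<integral>\<^sup>+x. F n x \<partial>M)" by simp
  have "\<exists>n. (\<integral>\<^sup>+x. G x \<partial>M) \<le> (\<integral>\<^sup>+x. F n x \<partial>M) + ennreal (\<epsilon> / 2)"
  proof (rule ccontr)
    assume "\<not> ?thesis"
    then have "(\<integral>\<^sup>+x. F n x \<partial>M) + ennreal (\<epsilon> / 2) \<le> (\<integral>\<^sup>+x. G x \<partial>M)" for n
      by (meson linear)
    then have "(SUP n. (\<integral>\<^sup>+x. F n x \<partial>M) + ennreal (\<epsilon> / 2)) \<le> (\<integral>\<^sup>+x. G x \<partial>M)"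
      by (intro SUP_least)
    then have "(\<integral>\<^sup>+x. G x \<partial>M) + ennreal (\<epsilon> / 2) \<le> (\<integral>\<^sup>+x. G x \<partial>M)"
      by (simp add: SUP ennreal_SUP_add_left)
    then show False using fin \<open>0 < \<epsilon>\<close>
      by (metis add.right_neutral ennreal_add_left_cancel_le ennreal_eq_0_iff infinity_ennreal_def
          le_zero_eq less_irrefl not_le half_gt_zero)
  qed
  then obtain n where n: "(\<integral>\<^sup>+x. G x \<partial>M) \<le> (\<integral>\<^sup>+x. F n x \<partial>M) + ennreal (\<epsilon> / 2)" by blast
  show ?thesis
  proof (rule that[of "\<epsilon> / (2 * (real n + 1))"])
    fix A assume A [measurable]: "A \<in> sets M" and le: "emeasure M A \<le> ennreal (\<epsilon> / (2 * (real n + 1)))"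
    let ?A = "\<integral>\<^sup>+x. G x * indicator A x \<partial>M"
    let ?B = "\<integral>\<^sup>+x. F n x * indicator (space M - A) x \<partial>M"
    let ?C = "\<integral>\<^sup>+x. F n x * indicator A x \<partial>M"
    have "?A + ?B = (\<integral>\<^sup>+x. G x * indicator A x + F n x * indicator (space M - A) x \<partial>M)"
      by (rule nn_integral_add[symmetric]) auto
    also have "\<dots> \<le> (\<integral>\<^sup>+x. G x \<partial>M)"
      using FG by (intro nn_integral_mono) (auto simp: indicator_def)
    also note n
    also have "(\<integral>\<^sup>+x. F n x \<partial>M) = (\<integral>\<^sup>+x. F n x * indicator A x + F n x * indicator (space M - A) x \<partial>M)"
      by (intro nn_integral_cong) (auto simp: indicator_def)
    also have "\<dots> = ?C + ?B" by (rule nn_integral_add) auto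
    finally have le1: "?B + ?A \<le> ?B + (?C + ennreal (\<epsilon> / 2))" by (simp add: ac_simps)
    have "?B \<le> (\<integral>\<^sup>+x. G x \<partial>M)" using FG by (intro nn_integral_mono) (auto simp: indicator_def)
    then have "?B < \<infinity>" using fin by (rule le_less_trans)
    with le1 have "?A \<le> ?C + ennreal (\<epsilon> / 2)" by (auto simp: ennreal_add_left_cancel_le)
    also have "?C \<le> (\<integral>\<^sup>+x. of_nat n * indicator A x \<partial>M)"
      by (intro nn_integral_mono) (auto simp: indicator_def F_def)
    also have "\<dots> = ennreal (real n) * emeasure M A"
      by (simp add: nn_integral_cmult_indicator ennreal_of_nat_eq_real_of_nat)
    also have "\<dots> \<le> ennreal (real n) * ennreal (\<epsilon> / (2 * (real n + 1)))"
      using le by (rule mult_left_mono) simp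
    also have "\<dots> \<le> ennreal (\<epsilon> / 2)"
      using \<open>0 < \<epsilon>\<close> by (subst ennreal_mult[symmetric]) (auto intro!: ennreal_leI simp: field_simps)
    finally show "?A \<le> ennreal \<epsilon>"
      using \<open>0 < \<epsilon>\<close> by (simp add: add_mono ennreal_plus[symmetric] del: ennreal_plus)
  qed (use \<open>0 < \<epsilon>\<close> in auto)
qed

lemma suminf_le_infsum_ennreal:
  fixes h :: "'b \<Rightarrow> ennreal"
  assumes "inj_on b J" "b ` J \<subseteq> B"
  shows "(\<Sum>n. if n \<in> J then h (b n) else 0) \<le> infsum h B"
proof (rule suminf_le_const[OF summableI])
  fix N
  have "(\<Sum>n<N. if n \<in> J then h (b n) else 0) = (\<Sum>n\<in>J \<inter> {..<N}. h (b n))"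
    by (subst Int_commute) (simp add: sum.inter_restrict)
  also have "\<dots> = sum h (b ` (J \<inter> {..<N}))"
    using assms(1) by (subst sum.reindex) (auto intro: inj_on_subset)
  also have "\<dots> \<le> infsum h B"
    using assms(2) by (subst nonneg_infsum_complete) (auto intro!: SUP_upper)
  finally show "(\<Sum>n<N. if n \<in> J then h (b n) else 0) \<le> infsum h B" .
qed

context growth_function
begin

abbreviation "\<mu> \<equiv> lebesgue_on \<Omega>"

text \<open>A uniform supply of cutoffs for the compact subsets of \<open>U\<close>: their gradients all live in \<open>S\<close>, and
  their energy densities all lie below one function \<open>G\<close>. Having \<open>S\<close> and \<open>G\<close> independent of the compact
  set is what later allows sets to be selected before the compact set is known.\<close>

definition barrier :: "'a set \<Rightarrow> 'a set \<Rightarrow> ('a \<Rightarrow> ennreal) \<Rightarrow> bool"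
  where "barrier U S G \<longleftrightarrow> open U \<and> U \<subseteq> \<Omega> \<and> S \<in> sets \<mu> \<and> G \<in> borel_measurable \<mu> \<and>
    (\<forall>K. compact K \<and> K \<subseteq> U \<longrightarrow> (\<exists>f g. cutoff_with_gradient \<Omega> f g \<and> (\<forall>x\<in>K. 1 \<le> f x) \<and>
      (\<forall>x. g x \<noteq> 0 \<longrightarrow> x \<in> S) \<and> (AE x in \<mu>. ennreal (\<Phi> x (norm (g x))) \<le> G x)))"

text \<open>Cut off each ball of the cover within its double, and take the soft maximum over a finite
  subcover of the compact set. Where it is nonzero, the gradient is controlled by that of a single
  ball, and \<open>\<Phi>\<close> at that height is one term of the sum.\<close>

lemma barrier_of_ball_cover:
  fixes b :: "nat \<Rightarrow> 'a \<times> real"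
  assumes b: "\<And>n. n \<in> J \<Longrightarrow> 0 < snd (b n)" "\<And>n. n \<in> J \<Longrightarrow> cball (fst (b n)) (2 * snd (b n)) \<subseteq> \<Omega>"
  shows "barrier (\<Union>n\<in>J. ball (fst (b n)) (snd (b n))) (\<Union>n\<in>J. ball (fst (b n)) (2 * snd (b n)))
    (\<lambda>x. \<Sum>n. if n \<in> J then ennreal (\<Phi> x (8 / snd (b n))) * indicator (ball (fst (b n)) (2 * snd (b n))) x else 0)"
    (is "barrier ?U ?S ?G")
  unfolding barrier_def
proof (intro conjI allI impI)
  have sub: "ball (fst (b n)) (snd (b n)) \<subseteq> \<Omega>" "ball (fst (b n)) (2 * snd (b n)) \<subseteq> \<Omega>" if "n \<in> J" for n
    using b(2)[OF that] b(1)[OF that] by (auto simp: subset_iff)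
  show "open ?U" by auto
  show "?U \<subseteq> \<Omega>" using sub by blast
  have "open ?S" by auto
  then have "?S \<in> sets lebesgue" by simp
  then show "?S \<in> sets \<mu>" using sub by (auto simp: sets_restrict_space_iff)
  show "?G \<in> borel_measurable \<mu>"
  proof (rule borel_measurable_suminf_order)
    fix n
    have [measurable]: "ball (fst (b n)) (2 * snd (b n)) \<in> sets lebesgue" by simp
    have [measurable]: "(\<lambda>x. indicator (ball (fst (b n)) (2 * snd (b n))) x :: ennreal) \<in> borel_measurable \<mu>"
      by (intro measurable_restrict_space1) measurable
    show "(\<lambda>x. if n \<in> J then ennreal (\<Phi> x (8 / snd (b n))) * indicator (ball (fst (b n)) (2 * snd (b n))) x else 0)
      \<in> borel_measurable \<mu>"
      using b(1)[of n] by (cases "n \<in> J") auto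
  qed
  fix K assume K: "compact K \<and> K \<subseteq> ?U"
  have "\<forall>n\<in>J. \<exists>u v. cutoff_with_gradient \<Omega> u v \<and> (\<forall>x\<in>ball (fst (b n)) (snd (b n)). 1 \<le> u x) \<and>
     (\<forall>x. norm (v x) \<le> 4 / snd (b n)) \<and> (\<forall>x. x \<notin> ball (fst (b n)) (2 * snd (b n)) \<longrightarrow> v x = 0)"
    using cutoff_ball b by metis
  then obtain u v where uv: "\<And>n. n \<in> J \<Longrightarrow> cutoff_with_gradient \<Omega> (u n) (v n)"
    "\<And>n x. n \<in> J \<Longrightarrow> x \<in> ball (fst (b n)) (snd (b n)) \<Longrightarrow> 1 \<le> u n x"
    "\<And>n x. n \<in> J \<Longrightarrow> norm (v n x) \<le> 4 / snd (b n)"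
    "\<And>n x. n \<in> J \<Longrightarrow> x \<notin> ball (fst (b n)) (2 * snd (b n)) \<Longrightarrow> v n x = 0"
    by metis
  obtain I where I: "I \<subseteq> J" "finite I" "K \<subseteq> (\<Union>n\<in>I. ball (fst (b n)) (snd (b n)))"
    using compactE_image[of K J "\<lambda>n. ball (fst (b n)) (snd (b n))"] K by auto
  obtain f g where fg: "cutoff_with_gradient \<Omega> f g"
    "\<And>n x. n \<in> I \<Longrightarrow> 1 \<le> u n x \<Longrightarrow> 1 \<le> f x"
    "\<And>x. g x \<noteq> 0 \<Longrightarrow> \<exists>n\<in>I. norm (g x) \<le> 2 * norm (v n x)"
    using cutoff_soft_max[OF I(2), of \<Omega> u v] uv(1) I(1) by blast
  have *: "\<exists>n\<in>J. norm (g x) \<le> 8 / snd (b n) \<and> x \<in> ball (fst (b n)) (2 * snd (b n))" if nz: "g x \<noteq> 0" for x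
  proof -
    obtain n where n: "n \<in> I" "norm (g x) \<le> 2 * norm (v n x)" using fg(3)[OF nz] by blast
    have nJ: "n \<in> J" using n I by auto
    have "norm (g x) \<le> 8 / snd (b n)" using n(2) uv(3)[OF nJ, of x] by simp
    moreover have "v n x \<noteq> 0" using n(2) nz by auto
    ultimately show ?thesis using uv(4)[OF nJ, of x] nJ by blast
  qed
  have "AE x in \<mu>. ennreal (\<Phi> x (norm (g x))) \<le> ?G x"
    using AE_continuous_mono
  proof eventually_elim
    case (elim x)
    show ?case
    proof (cases "g x = 0")
      case True then show ?thesis using \<Phi>_0 elim by simp
    next
      case False
      then obtain n where n: "n \<in> J" "norm (g x) \<le> 8 / snd (b n)" "x \<in> ball (fst (b n)) (2 * snd (b n))"
        using * by blast
      have "\<Phi> x (norm (g x)) \<le> \<Phi> x (8 / snd (b n))"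
        using elim n b(1)[of n] by (intro mono_onD[of "{0..}" "\<Phi> x"]) auto
      then have "ennreal (\<Phi> x (norm (g x))) \<le> (\<Sum>k\<in>{n}. if k \<in> J then ennreal (\<Phi> x (8 / snd (b k))) *
           indicator (ball (fst (b k)) (2 * snd (b k))) x else 0)"
        using n by (simp add: ennreal_leI)
      also have "\<dots> \<le> ?G x" by (rule sum_le_suminf[OF summableI]) auto
      finally show ?thesis .
    qed
  qed
  then show "\<exists>f g. cutoff_with_gradient \<Omega> f g \<and> (\<forall>x\<in>K. 1 \<le> f x) \<and>
      (\<forall>x. g x \<noteq> 0 \<longrightarrow> x \<in> ?S) \<and> (AE x in \<mu>. ennreal (\<Phi> x (norm (g x))) \<le> ?G x)"
    using fg(1,2) uv(2) I * by (intro exI[of _ f] exI[of _ g]) blast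
qed

text \<open>Covers by smaller and smaller balls with bounded premeasure give densities with bounded integral
  and supports of arbitrarily small volume. The compact set \<open>L\<close> serves to discard the balls whose
  doubles would leave \<open>\<Omega>\<close>.\<close>

lemma barriers_of_finite_Hausdorff_measure:
  assumes L: "compact L" "L \<subseteq> \<Omega>" and H: "H_Phi \<Phi> \<Omega> E < \<infinity>"
  shows "\<exists>M::real. 0 \<le> M \<and> (\<forall>\<delta>>0. \<exists>U S G. barrier U S G \<and> E \<inter> L \<subseteq> U \<and>
    emeasure \<mu> S \<le> ennreal \<delta> \<and> (\<integral>\<^sup>+x. G x \<partial>\<mu>) \<le> ennreal M)"
proof -
  obtain \<rho> where \<rho>: "\<rho> > 0" "(\<Union>x\<in>L. cball x \<rho>) \<subseteq> \<Omega>"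
    using compact_subset_open_imp_cball_epsilon_subset[OF L(1) open_domain L(2)] by blast
  obtain A where A: "0 \<le> A" "\<And>c r. 0 < r \<Longrightarrow> 2 * r \<le> 1 \<Longrightarrow> ball c (2 * r) \<subseteq> \<Omega> \<Longrightarrow>
    (\<integral>\<^sup>+x. ennreal (\<Phi> x (8 / r)) * indicator (ball c (2 * r)) x \<partial>\<mu>) \<le> ennreal A * h_Phi \<Phi> (c, r)"
    using \<Phi>_double_ball_le_h_Phi by blast
  define T where "T = enn2real (H_Phi \<Phi> \<Omega> E) + 1"
  have T0: "T \<ge> 0" by (simp add: T_def)
  have HT: "H_Phi \<Phi> \<Omega> E < ennreal T"
    using H by (cases "H_Phi \<Phi> \<Omega> E") (auto simp: T_def ennreal_less_iff simp del: ennreal_plus)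
  define B where "B = 2 ^ DIM('a) * c\<^sub>g / \<beta>\<^sub>3"
  have B0: "B \<ge> 0" using exponents \<beta>\<^sub>3 by (simp add: B_def)
  have "\<exists>U S G. barrier U S G \<and> E \<inter> L \<subseteq> U \<and>
    emeasure \<mu> S \<le> ennreal \<delta> \<and> (\<integral>\<^sup>+x. G x \<partial>\<mu>) \<le> ennreal (A * T)" if \<delta>: "0 < \<delta>" for \<delta> :: real
  proof -
    \<comment> \<open>Doubled balls have radius at most 1 by the first bound and stay within \<open>\<rho>\<close> of \<open>L\<close> by the third;
      the second and fourth make their total volume at most \<open>\<delta>\<close>.\<close>
    define \<kappa> where "\<kappa> = Min {1/2, \<beta>\<^sub>3, \<rho> / 3, \<delta> / (B * T + 1)}"
    have \<kappa>: "0 < \<kappa>" "\<kappa> \<le> 1/2" "\<kappa> \<le> \<beta>\<^sub>3" "\<kappa> \<le> \<rho> / 3" "\<kappa> \<le> \<delta> / (B * T + 1)"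
    proof -
      show "0 < \<kappa>" using \<beta>\<^sub>3 \<rho> \<delta> B0 T0 by (simp add: \<kappa>_def add_nonneg_pos)
    qed (unfold \<kappa>_def, (rule Min_le, simp, simp)+)
    have "H_Phi_kappa \<Phi> \<Omega> \<kappa> E \<le> H_Phi \<Phi> \<Omega> E"
      unfolding H_Phi_eq_SUP using \<kappa> by (intro SUP_upper) auto
    then have "H_Phi_kappa \<Phi> \<Omega> \<kappa> E < ennreal T" using HT by (rule le_less_trans)
    then obtain \<B> where \<B>: "\<B> \<in> ball_covers \<Omega> \<kappa> E" "infsum (h_Phi \<Phi>) \<B> < ennreal T"
      unfolding H_Phi_kappa_def by (auto simp: INF_less_iff)
    define \<B>' where "\<B>' = {B\<in>\<B>. ball (fst B) (snd B) \<inter> L \<noteq> {}}"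
    \<comment> \<open>Enumerating by a set \<open>J\<close> of indices treats finite and infinite covers alike.\<close>
    define J where "J = to_nat_on \<B>' ` \<B>'"
    define b where "b = from_nat_into \<B>'"
    have cnt: "countable \<B>'" using \<B>(1) by (auto simp: ball_covers_def \<B>'_def intro: countable_subset)
    have inj: "inj_on b J" and im: "b ` J = \<B>'"
      using cnt by (auto simp: b_def J_def inj_on_def image_image)
    have b: "0 < snd (b n) \<and> snd (b n) \<le> \<kappa> \<and> ball (fst (b n)) (snd (b n)) \<subseteq> \<Omega> \<and>
       ball (fst (b n)) (snd (b n)) \<inter> L \<noteq> {}" if "n \<in> J" for n
    proof -
      have "b n \<in> \<B>'" using im that by blast
      then show ?thesis using \<B>(1) by (cases "b n") (auto simp: ball_covers_def \<B>'_def)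
    qed
    have b2: "cball (fst (b n)) (2 * snd (b n)) \<subseteq> \<Omega>" if n: "n \<in> J" for n
    proof -
      obtain y where y: "y \<in> L" "dist (fst (b n)) y < snd (b n)" using b[OF n] by auto
      have "dist y z \<le> \<rho>" if "dist (fst (b n)) z \<le> 2 * snd (b n)" for z
        using that y(2) b[OF n] \<kappa>(4) dist_triangle[of y z "fst (b n)"] dist_commute[of y "fst (b n)"] by linarith
      then have "cball (fst (b n)) (2 * snd (b n)) \<subseteq> cball y \<rho>" by (auto simp: subset_iff)
      then show ?thesis using \<rho>(2) y(1) by blast
    qed
    have sub: "ball (fst (b n)) (2 * snd (b n)) \<subseteq> \<Omega>" if "n \<in> J" for n
      using b2[OF that] by auto
    have hsum: "(\<Sum>n. if n \<in> J then h_Phi \<Phi> (b n) else 0) \<le> ennreal T"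
      using suminf_le_infsum_ennreal[OF inj, of \<B> "h_Phi \<Phi>"] im \<B>(2) by (auto simp: \<B>'_def)
    define G where "G x = (\<Sum>n. if n \<in> J then ennreal (\<Phi> x (8 / snd (b n))) * indicator (ball (fst (b n)) (2 * snd (b n))) x else 0)" for x
    define S where "S = (\<Union>n\<in>J. ball (fst (b n)) (2 * snd (b n)))"
    define U where "U = (\<Union>n\<in>J. ball (fst (b n)) (snd (b n)))"
    have bar: "barrier U S G"
      unfolding U_def S_def G_def using b b2 by (intro barrier_of_ball_cover) auto
    have EU: "E \<inter> L \<subseteq> U"
    proof
      fix x assume x: "x \<in> E \<inter> L"
      then obtain c r where "(c, r) \<in> \<B>" "x \<in> ball c r" using \<B>(1) by (auto simp: ball_covers_def)
      then have "(c, r) \<in> \<B>'" using x by (auto simp: \<B>'_def)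
      then obtain n where "n \<in> J" "b n = (c, r)" using im by (metis imageE)
      then show "x \<in> U" using \<open>x \<in> ball c r\<close> unfolding U_def by (intro UN_I[of n]) auto
    qed
    have "(\<integral>\<^sup>+x. G x \<partial>\<mu>) = (\<Sum>n. \<integral>\<^sup>+x. (if n \<in> J then ennreal (\<Phi> x (8 / snd (b n))) * indicator (ball (fst (b n)) (2 * snd (b n))) x else 0) \<partial>\<mu>)"
      unfolding G_def
    proof (rule nn_integral_suminf)
      fix n
      have [measurable]: "ball (fst (b n)) (2 * snd (b n)) \<in> sets lebesgue" by simp
      have [measurable]: "(\<lambda>x. indicator (ball (fst (b n)) (2 * snd (b n))) x :: ennreal) \<in> borel_measurable \<mu>"
        by (intro measurable_restrict_space1) measurable
      show "(\<lambda>x. if n \<in> J then ennreal (\<Phi> x (8 / snd (b n))) * indicator (ball (fst (b n)) (2 * snd (b n))) x else 0)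
        \<in> borel_measurable \<mu>"
        using b[of n] by (cases "n \<in> J") auto
    qed
    also have "\<dots> \<le> (\<Sum>n. ennreal A * (if n \<in> J then h_Phi \<Phi> (b n) else 0))"
    proof (intro suminf_le summableI)
      fix n
      show "(\<integral>\<^sup>+x. (if n \<in> J then ennreal (\<Phi> x (8 / snd (b n))) * indicator (ball (fst (b n)) (2 * snd (b n))) x else 0) \<partial>\<mu>)
        \<le> ennreal A * (if n \<in> J then h_Phi \<Phi> (b n) else 0)"
        using A(2)[of "snd (b n)" "fst (b n)"] b[of n] sub[of n] \<kappa>(2) by (cases "n \<in> J") auto
    qed
    also have "\<dots> = ennreal A * (\<Sum>n. if n \<in> J then h_Phi \<Phi> (b n) else 0)" by (rule ennreal_suminf_cmult)
    also have "\<dots> \<le> ennreal A * ennreal T" using hsum by (rule mult_left_mono) simp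
    finally have Gint: "(\<integral>\<^sup>+x. G x \<partial>\<mu>) \<le> ennreal (A * T)" using A T0 by (simp add: ennreal_mult)
    define R where "R n = (if n \<in> J then ball (fst (b n)) (2 * snd (b n)) else {})" for n
    have SR: "S = (\<Union>n. R n)" by (auto simp: S_def R_def split: if_splits)
    have Rm: "R n \<in> sets lebesgue" for n by (simp add: R_def)
    have "S \<subseteq> \<Omega>" using sub by (auto simp: S_def)
    then have "emeasure \<mu> S = emeasure lebesgue S"
      by (subst emeasure_restrict_space) auto
    also have "\<dots> \<le> (\<Sum>n. emeasure lebesgue (R n))"
      unfolding SR using Rm by (intro emeasure_subadditive_countably) auto
    also have "\<dots> \<le> (\<Sum>n. ennreal (B * \<kappa>) * (if n \<in> J then h_Phi \<Phi> (b n) else 0))"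
    proof (intro suminf_le summableI)
      fix n
      show "emeasure lebesgue (R n) \<le> ennreal (B * \<kappa>) * (if n \<in> J then h_Phi \<Phi> (b n) else 0)"
        using emeasure_double_ball_le_h_Phi[of "snd (b n)" \<kappa> "fst (b n)"] b[of n] \<kappa>(3)
        by (cases "n \<in> J") (auto simp: R_def B_def)
    qed
    also have "\<dots> = ennreal (B * \<kappa>) * (\<Sum>n. if n \<in> J then h_Phi \<Phi> (b n) else 0)" by (rule ennreal_suminf_cmult)
    also have "\<dots> \<le> ennreal (B * \<kappa>) * ennreal T" using hsum by (rule mult_left_mono) simp
    also have "\<dots> = ennreal (B * T * \<kappa>)" using B0 T0 \<kappa>(1) by (simp add: ennreal_mult ac_simps)
    also have "\<dots> \<le> ennreal \<delta>"
    proof (rule ennreal_leI)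
      have BT: "0 \<le> B * T" using B0 T0 by simp
      have "B * T * \<kappa> \<le> (B * T + 1) * \<kappa>" using \<kappa>(1) by (simp add: algebra_simps)
      also have "\<dots> \<le> \<delta>" using \<kappa>(5) BT by (simp add: field_simps)
      finally show "B * T * \<kappa> \<le> \<delta>" .
    qed
    finally have "emeasure \<mu> S \<le> ennreal \<delta>" .
    then show ?thesis using bar EU Gint by blast
  qed
  then show ?thesis using A T0 by (intro exI[of _ "A * T"] conjI allI impI) simp_all
qed

section \<open>Averages over sparse families\<close>

text \<open>Let \<open>i\<close> be the last index whose gradient is nonzero at \<open>x\<close>. If this gradient dominates the
  earlier ones, the average is at most \<open>2 / N\<close> times it, and the exponent \<open>p\<close> yields the factor
  \<open>(2 / N) powr p\<close>. Otherwise the average is at most twice one of the earlier gradients, whose density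
  is then evaluated at a point of \<open>S i\<close>; such overlaps will be made negligible.\<close>

lemma sparse_average_pointwise:
  fixes v :: "nat \<Rightarrow> 'a" and G :: "nat \<Rightarrow> ennreal"
  assumes x: "x \<in> \<Omega>" and mono: "mono_on {0..} (\<Phi> x)" and N: "2 \<le> N"
    and v: "\<And>i. i < N \<Longrightarrow> v i \<noteq> 0 \<Longrightarrow> x \<in> S i"
    and G: "\<And>i. i < N \<Longrightarrow> ennreal (\<Phi> x (norm (v i))) \<le> G i"
  shows "ennreal (\<Phi> x (norm ((1 / real N) *\<^sub>R (\<Sum>i<N. v i)))) \<le>
    ennreal (c\<^sub>g * (2 / real N) powr p) * (\<Sum>i<N. G i) +
    ennreal (c\<^sub>g * 2 powr q) * (\<Sum>i<N. (\<Sum>j<i. G j) * indicator (S i) x)"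
    (is "ennreal (\<Phi> x (norm ?V)) \<le> ?R1 + ?R2")
proof (cases "\<forall>i<N. v i = 0")
  case True
  then show ?thesis using \<Phi>_0[OF x] by simp
next
  case False
  define i where "i = Max {i. i < N \<and> v i \<noteq> 0}"
  have fin: "finite {i. i < N \<and> v i \<noteq> 0}" and ne: "{i. i < N \<and> v i \<noteq> 0} \<noteq> {}" using False by auto
  have i: "i < N" "v i \<noteq> 0" using Max_in[OF fin ne] by (auto simp: i_def)
  have last: "v j = 0" if "i < j" "j < N" for j
  proof (rule ccontr)
    assume "v j \<noteq> 0"
    then have "j \<le> i" unfolding i_def using that fin by (intro Max_ge) auto
    then show False using that by simp
  qed
  define a where "a = norm (v i) / real N"
  define b where "b = (\<Sum>j<i. norm (v j)) / real N"
  have N0: "real N > 0" using N by simp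
  have ab0: "0 \<le> a" "0 \<le> b" using N0 by (auto simp: a_def b_def sum_nonneg)
  have "norm (\<Sum>j<N. v j) \<le> (\<Sum>j<N. norm (v j))" by (rule norm_sum)
  also have "\<dots> = (\<Sum>j<Suc i. norm (v j))"
    using i last by (intro sum.mono_neutral_right) auto
  finally have "norm ?V \<le> b + a"
    using N0 by (simp add: a_def b_def field_simps)
  show ?thesis
  proof (cases "b \<le> a")
    case True
    have "norm ?V \<le> (2 / real N) * norm (v i)" using \<open>norm ?V \<le> b + a\<close> True by (simp add: a_def)
    then have "\<Phi> x (norm ?V) \<le> \<Phi> x ((2 / real N) * norm (v i))"
      using N0 by (intro mono_onD[OF mono]) auto
    also have "\<dots> \<le> c\<^sub>g * (2 / real N) powr p * \<Phi> x (norm (v i))"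
      using x N by (intro \<Phi>_scale_le_1) auto
    finally have "ennreal (\<Phi> x (norm ?V)) \<le> ennreal (c\<^sub>g * (2 / real N) powr p) * ennreal (\<Phi> x (norm (v i)))"
      using exponents by (simp add: ennreal_leI ennreal_mult'[symmetric])
    also have "\<dots> \<le> ennreal (c\<^sub>g * (2 / real N) powr p) * G i"
      using G[OF i(1)] by (intro mult_left_mono) auto
    also have "\<dots> \<le> ?R1"
      using i(1) by (intro mult_left_mono member_le_sum) auto
    finally show ?thesis by (simp add: add_increasing2)
  next
    case False
    have "\<exists>j<i. b \<le> norm (v j)"
    proof (rule ccontr)
      assume "\<not> ?thesis"
      then have "(\<Sum>j<i. norm (v j)) \<le> (\<Sum>j<i. b)" by (intro sum_mono) auto
      moreover have "real N * b = (\<Sum>j<i. norm (v j))" using N0 by (simp add: b_def)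
      ultimately have "real N * b \<le> real i * b" by simp
      then show False using i(1) False ab0 by (simp add: mult_le_cancel_right)
    qed
    then obtain j where j: "j < i" "b \<le> norm (v j)" by blast
    have "norm ?V \<le> 2 * norm (v j)" using \<open>norm ?V \<le> b + a\<close> False j by simp
    then have "\<Phi> x (norm ?V) \<le> \<Phi> x (2 * norm (v j))"
      by (intro mono_onD[OF mono]) auto
    also have "\<dots> \<le> c\<^sub>g * 2 powr q * \<Phi> x (norm (v j))"
      using x by (intro \<Phi>_scale_ge_1) auto
    finally have "ennreal (\<Phi> x (norm ?V)) \<le> ennreal (c\<^sub>g * 2 powr q) * ennreal (\<Phi> x (norm (v j)))"
      using exponents by (simp add: ennreal_leI ennreal_mult'[symmetric])
    also have "\<dots> \<le> ennreal (c\<^sub>g * 2 powr q) * G j"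
      using G[of j] i j by (intro mult_left_mono) auto
    also have "\<dots> \<le> ennreal (c\<^sub>g * 2 powr q) * (\<Sum>j<i. G j)"
      using j(1) by (intro mult_left_mono member_le_sum) auto
    also have "\<dots> = ennreal (c\<^sub>g * 2 powr q) * ((\<Sum>j<i. G j) * indicator (S i) x)"
      using v[OF i] by simp
    also have "\<dots> \<le> ?R2"
      using i(1) by (intro mult_left_mono member_le_sum[of i "{..<N}" "\<lambda>i. (\<Sum>j<i. G j) * indicator (S i) x"]) auto
    finally show ?thesis by (simp add: add_increasing)
  qed
qed

text \<open>The capacity of an open set is bounded by \<open>\<epsilon>\<close>, witnessed by cutoffs.\<close>

definition energy_at_most :: "real \<Rightarrow> 'a set \<Rightarrow> bool"
  where "energy_at_most \<epsilon> U \<longleftrightarrow> (\<forall>K. compact K \<and> K \<subseteq> U \<longrightarrow> (\<exists>f g. cutoff_with_gradient \<Omega> f g \<and>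
    (\<forall>x\<in>K. 1 \<le> f x) \<and> (\<integral>\<^sup>+x. ennreal (\<Phi> x (norm (g x))) \<partial>\<mu>) \<le> ennreal \<epsilon>))"

text \<open>Select barriers one after another, each with so small a set \<open>S i\<close> that the densities of all
  previous ones integrate to almost nothing over it. The average of \<open>N\<close> cutoffs then has an energy of
  order \<open>N * N powr (- p) * M\<close>, which tends to zero because \<open>p > 1\<close>.\<close>

lemma energy_small_of_barriers:
  assumes M: "0 \<le> M"
    and ex: "\<forall>\<delta>>0. \<exists>U S G. barrier U S G \<and> X \<subseteq> U \<and>
      emeasure \<mu> S \<le> ennreal \<delta> \<and> (\<integral>\<^sup>+x. G x \<partial>\<mu>) \<le> ennreal M"
    and \<epsilon>: "0 < \<epsilon>"
  shows "\<exists>U. open U \<and> U \<subseteq> \<Omega> \<and> X \<subseteq> U \<and> energy_at_most \<epsilon> U"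
proof -
  have "(\<lambda>N. c\<^sub>g * 2 powr p * M * real N powr (1 - p)) \<longlonglongrightarrow> c\<^sub>g * 2 powr p * M * 0"
    using exponents by (intro tendsto_mult_left tendsto_neg_powr filterlim_real_sequentially) auto
  then have "\<forall>\<^sub>F N in sequentially. c\<^sub>g * 2 powr p * M * real N powr (1 - p) < \<epsilon> / 2"
    using \<epsilon> by (intro order_tendstoD) auto
  then have "\<forall>\<^sub>F N in sequentially. c\<^sub>g * 2 powr p * M * real N powr (1 - p) < \<epsilon> / 2 \<and> 2 \<le> N"
    using eventually_ge_at_top[of 2] by eventually_elim simp
  then obtain N where N: "c\<^sub>g * 2 powr p * M * real N powr (1 - p) < \<epsilon> / 2" "2 \<le> N"
    by (auto simp: eventually_sequentially)
  have N0: "real N > 0" using N by simp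
  define \<delta> where "\<delta> = \<epsilon> / (2 * (c\<^sub>g * 2 powr q) * real N)"
  have \<delta>: "0 < \<delta>" using \<epsilon> N0 exponents by (simp add: \<delta>_def)
  define P where "P f i r \<longleftrightarrow> (case r of (U, S, G) \<Rightarrow> barrier U S G \<and> X \<subseteq> U \<and>
      (\<integral>\<^sup>+x. G x \<partial>\<mu>) \<le> ennreal M \<and>
      (\<integral>\<^sup>+x. (\<Sum>j<i. snd (snd (f j)) x) * indicator S x \<partial>\<mu>) \<le> ennreal \<delta>)"
    for f :: "nat \<Rightarrow> 'a set \<times> 'a set \<times> ('a \<Rightarrow> ennreal)" and i r
  have "\<exists>f. \<forall>i. P f i (f i)"
  proof (rule dependent_wellorder_choice)
    fix r and f g :: "nat \<Rightarrow> 'a set \<times> 'a set \<times> ('a \<Rightarrow> ennreal)" and i :: nat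
    assume "\<And>j. j < i \<Longrightarrow> f j = g j"
    then show "P f i r = P g i r" by (simp add: P_def)
  next
    fix i :: nat and f
    assume IH: "\<And>j. j < i \<Longrightarrow> P f j (f j)"
    have [measurable]: "snd (snd (f j)) \<in> borel_measurable \<mu>" if "j < i" for j
      using IH[OF that] by (auto simp: P_def barrier_def split: prod.splits)
    have Gm: "(\<lambda>x. \<Sum>j<i. snd (snd (f j)) x) \<in> borel_measurable \<mu>"
      by (intro borel_measurable_sum) auto
    have "(\<integral>\<^sup>+x. (\<Sum>j<i. snd (snd (f j)) x) \<partial>\<mu>) = (\<Sum>j<i. \<integral>\<^sup>+x. snd (snd (f j)) x \<partial>\<mu>)"
      by (intro nn_integral_sum) auto
    also have "\<dots> \<le> (\<Sum>j<i. ennreal M)"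
    proof (rule sum_mono)
      fix j assume "j \<in> {..<i}"
      then show "(\<integral>\<^sup>+x. snd (snd (f j)) x \<partial>\<mu>) \<le> ennreal M"
        using IH[of j] by (cases "f j") (simp add: P_def)
    qed
    also have "\<dots> < \<infinity>" by (simp add: ennreal_mult_less_top of_nat_less_top)
    finally obtain d where d: "0 < d" "\<And>A. A \<in> sets \<mu> \<Longrightarrow> emeasure \<mu> A \<le> ennreal d \<Longrightarrow>
        (\<integral>\<^sup>+x. (\<Sum>j<i. snd (snd (f j)) x) * indicator A x \<partial>\<mu>) \<le> ennreal \<delta>"
      using nn_integral_absolute_continuity[OF Gm _ \<delta>] by blast
    obtain U S G where "barrier U S G" "X \<subseteq> U" "emeasure \<mu> S \<le> ennreal d" "(\<integral>\<^sup>+x. G x \<partial>\<mu>) \<le> ennreal M"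
      using ex d(1) by blast
    then show "\<exists>r. P f i r"
      using d(2)[of S] by (intro exI[of _ "(U, S, G)"]) (auto simp: P_def barrier_def)
  qed
  then obtain F where F: "\<And>i. P F i (F i)" by blast
  define U S G where "U i = fst (F i)" and "S i = fst (snd (F i))" and "G i = snd (snd (F i))" for i
  have bar: "barrier (U i) (S i) (G i)" and XU: "X \<subseteq> U i" and GM: "(\<integral>\<^sup>+x. G i x \<partial>\<mu>) \<le> ennreal M"
    and GS: "(\<integral>\<^sup>+x. (\<Sum>j<i. G j x) * indicator (S i) x \<partial>\<mu>) \<le> ennreal \<delta>" for i
    using F[of i] by (auto simp: P_def U_def S_def G_def split: prod.splits)
  have [measurable]: "G i \<in> borel_measurable \<mu>" "S i \<in> sets \<mu>" for i
    using bar[of i] by (auto simp: barrier_def)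
  define W where "W = (\<Inter>i<N. U i)"
  have "open W" unfolding W_def using bar by (intro open_INT) (auto simp: barrier_def)
  moreover have "W \<subseteq> \<Omega>" unfolding W_def using bar[of 0] N0 by (auto simp: barrier_def)
  moreover have "X \<subseteq> W" using XU by (auto simp: W_def)
  moreover have "energy_at_most \<epsilon> W"
    unfolding energy_at_most_def
  proof (intro allI impI)
    fix K assume K: "compact K \<and> K \<subseteq> W"
    define Q where "Q i f g \<longleftrightarrow> cutoff_with_gradient \<Omega> f g \<and> (\<forall>x\<in>K. 1 \<le> f x) \<and>
      (\<forall>x. g x \<noteq> 0 \<longrightarrow> x \<in> S i) \<and> (AE x in \<mu>. ennreal (\<Phi> x (norm (g x))) \<le> G i x)" for i f g
    have "\<exists>f g. Q i f g" if "i < N" for i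
    proof -
      have "compact K \<and> K \<subseteq> U i" using K that by (auto simp: W_def)
      then show ?thesis using bar[of i] by (simp add: barrier_def Q_def)
    qed
    then obtain f g where Q: "\<And>i. i < N \<Longrightarrow> Q i (f i) (g i)" by metis
    have fg: "cutoff_with_gradient \<Omega> (f i) (g i)" "\<And>x. x \<in> K \<Longrightarrow> 1 \<le> f i x"
      "\<And>x. g i x \<noteq> 0 \<Longrightarrow> x \<in> S i" "AE x in \<mu>. ennreal (\<Phi> x (norm (g i x))) \<le> G i x"
      if "i < N" for i
      using Q[OF that] by (auto simp: Q_def)
    define f' where "f' x = 1 / real N * (\<Sum>i<N. f i x)" for x
    define g' where "g' x = (1 / real N) *\<^sub>R (\<Sum>i<N. g i x)" for x
    have c: "cutoff_with_gradient \<Omega> f' g'"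
      unfolding f'_def g'_def using fg(1) by (intro cutoff_scaled_sum) auto
    have ge1: "1 \<le> f' x" if "x \<in> K" for x
    proof -
      have "(\<Sum>i<N. 1) \<le> (\<Sum>i<N. f i x)" using fg(2) that by (intro sum_mono) auto
      then show ?thesis using N0 by (simp add: f'_def)
    qed
    have "AE x in \<mu>. \<forall>i\<in>{..<N}. ennreal (\<Phi> x (norm (g i x))) \<le> G i x"
      using fg(4) by (intro AE_ball_countable[THEN iffD2]) auto
    then have "AE x in \<mu>. ennreal (\<Phi> x (norm (g' x))) \<le>
      ennreal (c\<^sub>g * (2 / real N) powr p) * (\<Sum>i<N. G i x) +
      ennreal (c\<^sub>g * 2 powr q) * (\<Sum>i<N. (\<Sum>j<i. G j x) * indicator (S i) x)"
      using AE_continuous_mono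
    proof eventually_elim
      case (elim x)
      then show ?case unfolding g'_def using fg(3) N(2)
        by (intro sparse_average_pointwise) auto
    qed
    then have "(\<integral>\<^sup>+x. ennreal (\<Phi> x (norm (g' x))) \<partial>\<mu>) \<le> (\<integral>\<^sup>+x.
      ennreal (c\<^sub>g * (2 / real N) powr p) * (\<Sum>i<N. G i x) +
      ennreal (c\<^sub>g * 2 powr q) * (\<Sum>i<N. (\<Sum>j<i. G j x) * indicator (S i) x) \<partial>\<mu>)"
      by (rule nn_integral_mono_AE)
    also have "\<dots> = ennreal (c\<^sub>g * (2 / real N) powr p) * (\<Sum>i<N. \<integral>\<^sup>+x. G i x \<partial>\<mu>) +
      ennreal (c\<^sub>g * 2 powr q) * (\<Sum>i<N. \<integral>\<^sup>+x. (\<Sum>j<i. G j x) * indicator (S i) x \<partial>\<mu>)"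
    proof -
      have Tm: "(\<lambda>x. (\<Sum>j<i. G j x) * indicator (S i) x) \<in> borel_measurable \<mu>" for i by measurable
      have m1: "(\<lambda>x. \<Sum>i<N. G i x) \<in> borel_measurable \<mu>"
        and m2: "(\<lambda>x. \<Sum>i<N. (\<Sum>j<i. G j x) * indicator (S i) x) \<in> borel_measurable \<mu>"
        by (intro borel_measurable_sum Tm; simp)+
      have s: "(\<integral>\<^sup>+x. (\<Sum>i<N. G i x) \<partial>\<mu>) = (\<Sum>i<N. \<integral>\<^sup>+x. G i x \<partial>\<mu>)"
        "(\<integral>\<^sup>+x. (\<Sum>i<N. (\<Sum>j<i. G j x) * indicator (S i) x) \<partial>\<mu>) =
          (\<Sum>i<N. \<integral>\<^sup>+x. (\<Sum>j<i. G j x) * indicator (S i) x \<partial>\<mu>)"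
        by (intro nn_integral_sum Tm; simp)+
      show ?thesis
        unfolding s[symmetric] nn_integral_cmult[OF m1, symmetric] nn_integral_cmult[OF m2, symmetric]
        using m1 m2 by (intro nn_integral_add borel_measurable_times_ennreal) auto
    qed
    also have "\<dots> \<le> ennreal (c\<^sub>g * (2 / real N) powr p) * (\<Sum>i<N. ennreal M) +
      ennreal (c\<^sub>g * 2 powr q) * (\<Sum>i<N. ennreal \<delta>)"
      by (intro add_mono mult_left_mono sum_mono GM GS) auto
    also have "\<dots> = ennreal (c\<^sub>g * (2 / real N) powr p) * ennreal (real N * M) +
      ennreal (c\<^sub>g * 2 powr q) * ennreal (real N * \<delta>)"
      using M \<delta> by (subst (1 2) sum_ennreal) auto
    also have "\<dots> = ennreal (c\<^sub>g * (2 / real N) powr p * (real N * M) + c\<^sub>g * 2 powr q * (real N * \<delta>))"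
      using M \<delta> exponents by (subst (1 2) ennreal_mult[symmetric], simp_all del: ennreal_plus add: ennreal_plus[symmetric])
    also have "\<dots> \<le> ennreal \<epsilon>"
    proof (rule ennreal_leI)
      have "(2 / real N) powr p * real N = 2 powr p * real N powr (1 - p)"
        using N0 by (simp add: powr_divide powr_diff)
      then have "c\<^sub>g * (2 / real N) powr p * (real N * M) = c\<^sub>g * 2 powr p * M * real N powr (1 - p)"
        by (simp add: algebra_simps)
      moreover have "c\<^sub>g * 2 powr q * (real N * \<delta>) = \<epsilon> / 2"
        using N0 exponents by (simp add: \<delta>_def)
      ultimately show "c\<^sub>g * (2 / real N) powr p * (real N * M) + c\<^sub>g * 2 powr q * (real N * \<delta>) \<le> \<epsilon>"
        using N(1) by linarith
    qed
    finally show "\<exists>f g. cutoff_with_gradient \<Omega> f g \<and> (\<forall>x\<in>K. 1 \<le> f x) \<and>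
        (\<integral>\<^sup>+x. ennreal (\<Phi> x (norm (g x))) \<partial>\<mu>) \<le> ennreal \<epsilon>"
      using c ge1 by blast
  qed
  ultimately show ?thesis by blast
qed

section \<open>Countable unions and capacity\<close>

text \<open>Needed because cutoffs are available only for compact subsets of each single \<open>U n\<close>.\<close>

lemma compact_subset_UN_split:
  assumes K: "compact K" "K \<subseteq> (\<Union>n. U n)" and U: "\<And>n. open (U n :: 'a set)"
  obtains I L where "finite I" "\<And>n. n \<in> I \<Longrightarrow> compact (L n) \<and> L n \<subseteq> U n" "K \<subseteq> (\<Union>n\<in>I. L n)"
proof -
  have "\<forall>x\<in>K. \<exists>n e. 0 < e \<and> cball x e \<subseteq> U n"
    using K(2) U open_contains_cball by (metis UN_E subsetD)
  then obtain n e where ne: "\<And>x. x \<in> K \<Longrightarrow> 0 < e x" "\<And>x. x \<in> K \<Longrightarrow> cball x (e x) \<subseteq> U (n x)" by metis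
  obtain D where D: "D \<subseteq> K" "finite D" "K \<subseteq> (\<Union>x\<in>D. ball x (e x))"
  proof (rule compactE_image[OF K(1), of K "\<lambda>x. ball x (e x)"])
    show "K \<subseteq> (\<Union>x\<in>K. ball x (e x))" using ne(1) by force
  qed auto
  show ?thesis
  proof (rule that[of "n ` D" "\<lambda>k. \<Union>x\<in>{x\<in>D. n x = k}. cball x (e x)"])
    show "compact (\<Union>x\<in>{x\<in>D. n x = k}. cball x (e x)) \<and> (\<Union>x\<in>{x\<in>D. n x = k}. cball x (e x)) \<subseteq> U k" for k
      using ne(2) D by (auto intro!: compact_UN)
    show "K \<subseteq> (\<Union>k\<in>n ` D. \<Union>x\<in>{x\<in>D. n x = k}. cball x (e x))"
    proof
      fix y assume "y \<in> K"
      then obtain x where "x \<in> D" "y \<in> ball x (e x)" using D(3) by blast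
      then show "y \<in> (\<Union>k\<in>n ` D. \<Union>x\<in>{x\<in>D. n x = k}. cball x (e x))"
        by (auto intro: less_imp_le)
    qed
  qed (use D in auto)
qed

lemma energy_at_most_countable_union:
  assumes U: "\<And>n. open (U n)" "\<And>n. energy_at_most (e n) (U n)" and e: "\<And>n. 0 \<le> e n" "summable e"
  shows "energy_at_most (c\<^sub>g * 2 powr q * suminf e) (\<Union>n. U n)"
  unfolding energy_at_most_def
proof (intro allI impI)
  fix K assume "compact K \<and> K \<subseteq> (\<Union>n. U n)"
  then obtain I L where I: "finite I" "\<And>n. n \<in> I \<Longrightarrow> compact (L n) \<and> L n \<subseteq> U n" "K \<subseteq> (\<Union>n\<in>I. L n)"
    using compact_subset_UN_split[of K U] U(1) by blast
  define Q where "Q n f g \<longleftrightarrow> cutoff_with_gradient \<Omega> f g \<and> (\<forall>x\<in>L n. 1 \<le> f x) \<and>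
    (\<integral>\<^sup>+x. ennreal (\<Phi> x (norm (g x))) \<partial>\<mu>) \<le> ennreal (e n)" for n f g
  have "\<exists>f g. Q n f g" if "n \<in> I" for n
    using I(2)[OF that] U(2)[of n] by (simp add: energy_at_most_def Q_def)
  then obtain u v where Q: "\<And>n. n \<in> I \<Longrightarrow> Q n (u n) (v n)" by metis
  have uv: "cutoff_with_gradient \<Omega> (u n) (v n)" "\<And>x. x \<in> L n \<Longrightarrow> 1 \<le> u n x"
    "(\<integral>\<^sup>+x. ennreal (\<Phi> x (norm (v n x))) \<partial>\<mu>) \<le> ennreal (e n)" if "n \<in> I" for n
    using Q[OF that] by (auto simp: Q_def)
  obtain f g where fg: "cutoff_with_gradient \<Omega> f g"
    "\<And>n x. n \<in> I \<Longrightarrow> 1 \<le> u n x \<Longrightarrow> 1 \<le> f x"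
    "\<And>x. g x \<noteq> 0 \<Longrightarrow> \<exists>n\<in>I. norm (g x) \<le> 2 * norm (v n x)"
    using cutoff_soft_max[OF I(1), of \<Omega> u v] uv(1) by blast
  have vm: "(\<lambda>x. \<Phi> x (norm (v n x))) \<in> borel_measurable \<mu>" if "n \<in> I" for n
  proof (rule \<Phi>_compose_measurable)
    have "integrable \<mu> (v n)"
      using cutoff_weak_gradient(2)[OF uv(1)[OF that] open_domain]
      by (rule integrable_lborel_imp_lebesgue_on) simp
    then have [measurable]: "v n \<in> borel_measurable \<mu>" by simp
    show "(\<lambda>x. norm (v n x)) \<in> borel_measurable \<mu>" by measurable
  qed simp
  have "AE x in \<mu>. ennreal (\<Phi> x (norm (g x))) \<le> ennreal (c\<^sub>g * 2 powr q) * (\<Sum>n\<in>I. ennreal (\<Phi> x (norm (v n x))))"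
    using AE_continuous_mono
  proof eventually_elim
    case (elim x)
    show ?case
    proof (cases "g x = 0")
      case True then show ?thesis using elim \<Phi>_0 by simp
    next
      case False
      then obtain n where n: "n \<in> I" "norm (g x) \<le> 2 * norm (v n x)" using fg(3) by blast
      have "\<Phi> x (norm (g x)) \<le> \<Phi> x (2 * norm (v n x))"
        using elim n by (intro mono_onD[of "{0..}" "\<Phi> x"]) auto
      also have "\<dots> \<le> c\<^sub>g * 2 powr q * \<Phi> x (norm (v n x))"
        using elim by (intro \<Phi>_scale_ge_1) auto
      finally have "ennreal (\<Phi> x (norm (g x))) \<le> ennreal (c\<^sub>g * 2 powr q) * ennreal (\<Phi> x (norm (v n x)))"
        using exponents by (simp add: ennreal_leI ennreal_mult'[symmetric])
      also have "\<dots> \<le> ennreal (c\<^sub>g * 2 powr q) * (\<Sum>n\<in>I. ennreal (\<Phi> x (norm (v n x))))"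
        using n(1) I(1) by (intro mult_left_mono member_le_sum[of n I "\<lambda>n. ennreal (\<Phi> x (norm (v n x)))"]) auto
      finally show ?thesis .
    qed
  qed
  then have "(\<integral>\<^sup>+x. ennreal (\<Phi> x (norm (g x))) \<partial>\<mu>) \<le>
      (\<integral>\<^sup>+x. ennreal (c\<^sub>g * 2 powr q) * (\<Sum>n\<in>I. ennreal (\<Phi> x (norm (v n x)))) \<partial>\<mu>)"
    by (rule nn_integral_mono_AE)
  also have "\<dots> = ennreal (c\<^sub>g * 2 powr q) * (\<Sum>n\<in>I. \<integral>\<^sup>+x. ennreal (\<Phi> x (norm (v n x))) \<partial>\<mu>)"
    using vm by (subst nn_integral_cmult) (auto intro!: borel_measurable_sum simp: nn_integral_sum)
  also have "\<dots> \<le> ennreal (c\<^sub>g * 2 powr q) * (\<Sum>n\<in>I. ennreal (e n))"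
    using uv(3) by (intro mult_left_mono sum_mono) auto
  also have "\<dots> = ennreal (c\<^sub>g * 2 powr q * (\<Sum>n\<in>I. e n))"
    using e(1) exponents by (simp add: ennreal_mult')
  also have "\<dots> \<le> ennreal (c\<^sub>g * 2 powr q * suminf e)"
    using e I(1) exponents by (intro ennreal_leI mult_left_mono sum_le_suminf) auto
  finally have "(\<integral>\<^sup>+x. ennreal (\<Phi> x (norm (g x))) \<partial>\<mu>) \<le> ennreal (c\<^sub>g * 2 powr q * suminf e)" .
  moreover have "\<forall>x\<in>K. 1 \<le> f x"
  proof
    fix x assume "x \<in> K"
    then obtain n where "n \<in> I" "x \<in> L n" using I(3) by blast
    then show "1 \<le> f x" using fg(2) uv(2) by blast
  qed
  ultimately show "\<exists>f g. cutoff_with_gradient \<Omega> f g \<and> (\<forall>x\<in>K. 1 \<le> f x) \<and>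
      (\<integral>\<^sup>+x. ennreal (\<Phi> x (norm (g x))) \<partial>\<mu>) \<le> ennreal (c\<^sub>g * 2 powr q * suminf e)"
    using fg(1) by (intro exI[of _ f] exI[of _ g] conjI)
qed

lemma Cap_le_energy:
  assumes "open U" "E \<subseteq> U" "U \<subseteq> \<Omega>" "energy_at_most \<epsilon> U"
  shows "Cap \<Phi> \<Omega> E \<le> ennreal \<epsilon>"
proof -
  have "Cap_star \<Phi> \<Omega> K \<le> ennreal \<epsilon>" if K: "compact K \<and> K \<subseteq> U" for K
  proof -
    obtain f g where c: "cutoff_with_gradient \<Omega> f g" and ge1: "\<And>x. x \<in> K \<Longrightarrow> 1 \<le> f x"
      and le: "(\<integral>\<^sup>+x. ennreal (\<Phi> x (norm (g x))) \<partial>\<mu>) \<le> ennreal \<epsilon>"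
      using assms(4)[unfolded energy_at_most_def, rule_format, OF K] by blast
    show ?thesis using Cap_star_le_cutoff_energy[OF c ge1] le by (rule order_trans)
  qed
  then have "Cap_open \<Phi> \<Omega> U \<le> ennreal \<epsilon>"
    unfolding Cap_open_def by (intro SUP_least) auto
  moreover have "Cap \<Phi> \<Omega> E \<le> Cap_open \<Phi> \<Omega> U"
    unfolding Cap_def using assms by (intro INF_lower) auto
  ultimately show ?thesis by (rule order_trans[rotated])
qed

theorem Cap_eq_0_of_finite_Hausdorff_measure:
  assumes E: "E \<subseteq> \<Omega>" and H: "H_Phi \<Phi> \<Omega> E < \<infinity>"
  shows "Cap \<Phi> \<Omega> E = 0"
proof -
  have "\<exists>C :: nat \<Rightarrow> 'a set. (\<forall>n. compact (C n)) \<and> (\<forall>n. C n \<subseteq> \<Omega>) \<and> (\<Union>n. C n) = \<Omega>"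
  proof (rule open_Union_compact_subsets[OF open_domain])
    fix C :: "nat \<Rightarrow> 'a set"
    assume "\<And>n. compact (C n)" "\<And>n. C n \<subseteq> \<Omega>" "\<Union>(range C) = \<Omega>"
    then show ?thesis by (intro exI[of _ C] conjI allI)
  qed
  then obtain C :: "nat \<Rightarrow> 'a set"
    where C: "\<And>n. compact (C n)" "\<And>n. C n \<subseteq> \<Omega>" "(\<Union>n. C n) = \<Omega>" by blast
  have small: "\<exists>U. open U \<and> U \<subseteq> \<Omega> \<and> E \<inter> C n \<subseteq> U \<and> energy_at_most \<epsilon> U" if \<epsilon>: "0 < \<epsilon>" for n \<epsilon>
  proof -
    from barriers_of_finite_Hausdorff_measure[OF C(1)[of n] C(2)[of n] H]
    obtain M :: real where M: "0 \<le> M \<and> (\<forall>\<delta>>0. \<exists>U S G. barrier U S G \<and> E \<inter> C n \<subseteq> U \<and>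
      emeasure \<mu> S \<le> ennreal \<delta> \<and> (\<integral>\<^sup>+x. G x \<partial>\<mu>) \<le> ennreal M)" ..
    show ?thesis using conjunct1[OF M] conjunct2[OF M] \<epsilon> by (rule energy_small_of_barriers)
  qed
  have le: "Cap \<Phi> \<Omega> E \<le> ennreal \<epsilon>" if \<epsilon>: "0 < \<epsilon>" for \<epsilon>
  proof -
    define D where "D = c\<^sub>g * 2 powr q"
    have D: "D > 0" using exponents by (simp add: D_def)
    define e where "e n = \<epsilon> / D * (1/2) ^ Suc n" for n
    have e: "e sums (\<epsilon> / D)"
      unfolding e_def using sums_mult[OF power_half_series, of "\<epsilon> / D"] by simp
    have e0: "0 < e n" for n using \<epsilon> D by (simp add: e_def)
    have "\<forall>n. \<exists>U. open U \<and> U \<subseteq> \<Omega> \<and> E \<inter> C n \<subseteq> U \<and> energy_at_most (e n) U"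
      using small[OF e0] by (rule allI)
    from choice[OF this] obtain U where
      U: "\<forall>n. open (U n) \<and> U n \<subseteq> \<Omega> \<and> E \<inter> C n \<subseteq> U n \<and> energy_at_most (e n) (U n)" ..
    have "energy_at_most (c\<^sub>g * 2 powr q * suminf e) (\<Union>n. U n)"
    proof (rule energy_at_most_countable_union)
      show "open (U n)" "energy_at_most (e n) (U n)" for n using U by simp_all
      show "0 \<le> e n" for n using e0[of n] by simp
      show "summable e" using e by (rule sums_summable)
    qed
    moreover have "c\<^sub>g * 2 powr q * suminf e = \<epsilon>"
      using sums_unique[OF e, symmetric] D unfolding D_def[symmetric] by simp
    ultimately have "energy_at_most \<epsilon> (\<Union>n. U n)" by simp
    moreover have "open (\<Union>n. U n)" using U by (intro open_UN ballI) simp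
    moreover have "(\<Union>n. U n) \<subseteq> \<Omega>" using U by blast
    moreover have "E \<subseteq> (\<Union>n. U n)"
    proof
      fix x assume x: "x \<in> E"
      then obtain n where "x \<in> C n" using E C(3) by blast
      then have "x \<in> U n" using U x by blast
      then show "x \<in> (\<Union>n. U n)" by blast
    qed
    ultimately show ?thesis by (intro Cap_le_energy)
  qed
  have "Cap \<Phi> \<Omega> E \<le> 0"
  proof (rule ennreal_le_epsilon)
    fix \<epsilon> :: real assume "0 < \<epsilon>"
    then show "Cap \<Phi> \<Omega> E \<le> 0 + ennreal \<epsilon>" using le by simp
  qed
  then show ?thesis by simp
qed

end

theorem theorem2:
  fixes \<Omega> E :: "'a::euclidean_space set"
    and \<Phi> :: "'a \<Rightarrow> real \<Rightarrow> real"
    and m :: "'a \<Rightarrow> real"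
    and C\<^sub>1 C\<^sub>2 \<beta>\<^sub>3 \<beta>\<^sub>4 c\<^sub>d c\<^sub>g p q :: real
  assumes "DIM('a) \<ge> 2" and "open \<Omega>"
    and "caratheodory \<Omega> \<Phi>"
    and "\<forall>x\<in>\<Omega>. \<Phi> x 0 = 0"
    and "\<forall>x\<in>\<Omega>. filterlim (\<Phi> x) at_top at_top"
    and "\<forall>x\<in>\<Omega>. 0 \<le> m x" and "locally_integrable \<Omega> m"
    and "\<forall>t\<ge>1. AE x in lebesgue_on \<Omega>. \<Phi> x t \<le> C\<^sub>1 * (m x * t ^ DIM('a))"
    and "0 < \<beta>\<^sub>3" and "\<beta>\<^sub>3 < 1"
    and "\<forall>x\<in>\<Omega>. \<Phi> x \<beta>\<^sub>3 \<le> 1 \<and> \<Phi> x (1 / \<beta>\<^sub>3) \<ge> 1"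
    and "\<forall>x\<in>\<Omega>. \<forall>s t. 0 < s \<and> s \<le> t \<longrightarrow> \<Phi> x s / s \<le> C\<^sub>2 * (\<Phi> x t / t)"
    and "0 < \<beta>\<^sub>4" and "\<beta>\<^sub>4 \<le> 1" and "1 \<le> c\<^sub>d"
    and "\<forall>c r t. 0 < r \<and> r \<le> 1 \<and> ball c r \<subseteq> \<Omega> \<and> 1 \<le> t \<and> t \<le> 1 / r \<longrightarrow>
      esssup (lebesgue_on (ball c r)) (\<lambda>x. ereal (\<Phi> x (\<beta>\<^sub>4 * t)))
        \<le> ereal c\<^sub>d * essinf (lebesgue_on (ball c r)) (\<lambda>x. ereal (\<Phi> x t))"
    and "1 < p" and "p < q" and "1 \<le> c\<^sub>g"
    and "\<forall>x\<in>\<Omega>. \<forall>s t. 0 < s \<and> s \<le> t \<longrightarrow>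
      \<Phi> x s / s powr p \<le> c\<^sub>g * (\<Phi> x t / t powr p) \<and>
      \<Phi> x t / t powr q \<le> c\<^sub>g * (\<Phi> x s / s powr q)"
    and "E \<subseteq> \<Omega>" and "H_Phi \<Phi> \<Omega> E < \<infinity>"
  shows "Cap \<Phi> \<Omega> E = 0"
proof -
  interpret growth_function \<Omega> \<Phi> m C\<^sub>1 \<beta>\<^sub>3 \<beta>\<^sub>4 c\<^sub>d c\<^sub>g p q
    by unfold_locales (use assms in blast)+
  show ?thesis
    using assms by (intro Cap_eq_0_of_finite_Hausdorff_measure)
qed

end
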